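(* There exists a piecewise affine, globally continuous map $T:[0,1]^2\to[0,1]^2$ such that $$h_{\mathrm{top}}(T)=\sup_\mu h(T,\mu)=\log 2,$$ where the supremum is over all $T$-invariant Borel probability measures $\mu$ on $[0,1]^2$, and such that $T$ has no maximal entropy measure, i.e., there is no $T$-invariant Borel probability measure $\mu$ on $[0,1]^2$ with $h(T,\mu)=\log 2$.
   Context: A map $T:[0,1]^2\to[0,1]^2$ is called piecewise affine if there exists a finite partition of $[0,1]^2$ such that, for each element $A$ of the partition, the restriction $T|A$ is the restriction to $A$ of an affine map $\mathbb R^2\to\mathbb R^2$ (a linear map followed by a translation). "Globally continuous" means that $T$ is continuous on all of $[0,1]^2$. $h_{\mathrm{top}}(T)$ denotes the topological entropy of $T$, and $h(T,\mu)$ the Kolmogorov–Sinai (measure-theoretic) entropy of $T$ with respect to an invariant probability measure $\mu$; natural logarithms are used. A maximal entropy measure is a $T$-invariant Borel probability measure $\mu$ with $h(T,\mu)=h_{\mathrm{top}}(T)$. *)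

theory Defs
  imports "HOL-Probability.Probability"
begin

definition unit_square :: "(real \<times> real) set" where
  "unit_square = {0..1} \<times> {0..1}"

definition piecewise_affine_on ::
    "'a::real_vector set \<Rightarrow> ('a \<Rightarrow> 'b::real_vector) \<Rightarrow> bool" where
  "piecewise_affine_on S T \<longleftrightarrow>
     (\<exists>P. finite P \<and> partition_on S P \<and>
        (\<forall>A\<in>P. \<exists>L b. linear L \<and> (\<forall>x\<in>A. T x = L x + b)))"

text \<open>
  Topological entropy of \<open>T\<close> on a compact set \<open>K\<close> with \<open>T ` K \<subseteq> K\<close>, following Bowen: the limit
  as \<open>\<epsilon>\<close> tends to \<open>0\<close> of \<open>limsup\<close> of \<open>(1/n) ln r(n, \<epsilon>)\<close>, where \<open>r(n, \<epsilon>)\<close> is the least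
  cardinality of an \<open>(n, \<epsilon>)\<close>-spanning set.  The infimum is taken after the monotone function
  \<open>(1/n) ln\<close> has been applied; being in \<^typ>\<open>ereal\<close>, it would be infinite if there were no
  finite spanning set.  The limit over \<open>\<epsilon>\<close> is a supremum because \<open>r(n, \<epsilon>)\<close> is antitone in \<open>\<epsilon>\<close>.
\<close>

definition spanning_set ::
    "'a::metric_space set \<Rightarrow> ('a \<Rightarrow> 'a) \<Rightarrow> nat \<Rightarrow> real \<Rightarrow> 'a set \<Rightarrow> bool" where
  "spanning_set K T n \<epsilon> E \<longleftrightarrow>
     finite E \<and> E \<subseteq> K \<and>
     (\<forall>x\<in>K. \<exists>y\<in>E. \<forall>k<n. dist ((T ^^ k) x) ((T ^^ k) y) < \<epsilon>)"

definition topological_entropy :: "'a::metric_space set \<Rightarrow> ('a \<Rightarrow> 'a) \<Rightarrow> ereal" where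
  "topological_entropy K T =
     (SUP \<epsilon>\<in>{0<..}. limsup (\<lambda>n.
        INF E\<in>{E. spanning_set K T n \<epsilon> E}. ereal (ln (real (card E)) / real n)))"

definition invariant_prob_measures ::
    "'a::topological_space set \<Rightarrow> ('a \<Rightarrow> 'a) \<Rightarrow> 'a measure set" where
  "invariant_prob_measures K T =
     {\<mu>. sets \<mu> = sets (restrict_space borel K) \<and> prob_space \<mu> \<and>
          T \<in> measurable \<mu> \<mu> \<and> distr \<mu> \<mu> T = \<mu>}"

definition finite_measurable_partition :: "'a measure \<Rightarrow> 'a set set \<Rightarrow> bool" where
  "finite_measurable_partition M P \<longleftrightarrow>
     finite P \<and> P \<subseteq> sets M \<and> partition_on (space M) P"

text \<open>The convention \<open>0 ln 0 = 0\<close> holds since \<open>0 * x = 0\<close>.\<close>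

definition partition_entropy :: "'a measure \<Rightarrow> 'a set set \<Rightarrow> real" where
  "partition_entropy M P = - (\<Sum>A\<in>P. measure M A * ln (measure M A))"

text \<open>
  \<open>refined_partition M T P n\<close> is the join of the preimages of \<open>P\<close> under \<open>T ^^ k\<close> for \<open>k < n\<close>.
  It may contain the empty set, which contributes nothing to the entropy; any other member arises
  from exactly one choice of members of \<open>P\<close>.
\<close>

primrec refined_partition ::
    "'a measure \<Rightarrow> ('a \<Rightarrow> 'a) \<Rightarrow> 'a set set \<Rightarrow> nat \<Rightarrow> 'a set set" where
  "refined_partition M T P 0 = {space M}"
| "refined_partition M T P (Suc n) =
     {A \<inter> ((T ^^ n) -` B \<inter> space M) | A B. A \<in> refined_partition M T P n \<and> B \<in> P}"

text \<open>
  Kolmogorov-Sinai entropy.  For an invariant probability measure the sequence below converges, by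
  subadditivity, so that the \<open>limsup\<close> is the usual limit.
\<close>

definition ks_entropy_partition ::
    "'a measure \<Rightarrow> ('a \<Rightarrow> 'a) \<Rightarrow> 'a set set \<Rightarrow> ereal" where
  "ks_entropy_partition M T P =
     limsup (\<lambda>n. ereal (partition_entropy M (refined_partition M T P n) / real n))"

definition ks_entropy :: "('a \<Rightarrow> 'a) \<Rightarrow> 'a measure \<Rightarrow> ereal" where
  "ks_entropy T M = (SUP P\<in>{P. finite_measurable_partition M P}. ks_entropy_partition M T P)"

definition maximal_entropy_measure ::
    "'a::metric_space set \<Rightarrow> ('a \<Rightarrow> 'a) \<Rightarrow> 'a measure \<Rightarrow> bool" where
  "maximal_entropy_measure K T \<mu> \<longleftrightarrow>
     \<mu> \<in> invariant_prob_measures K T \<and> ks_entropy T \<mu> = topological_entropy K T"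

end

theory Submission
  imports Defs "HOL-Real_Asymp.Real_Asymp"
begin

text \<open>
  On the cone \<open>0 \<le> x \<le> y\<close> the map is homogeneous near the origin.  The slope \<open>x / y\<close> has two full
  branches: on \<open>4 x \<le> y\<close> the height \<open>y\<close> is halved and on \<open>y \<le> 2 x\<close> it is doubled (and cut off at \<open>1\<close>).
  Everything else is wandering and only serves to make the map continuous.  Hence an orbit is coded by
  an arbitrary two-letter sequence, along which the logarithm of the height performs a random walk on
  the half-line that is reflected at \<open>0\<close>.  Given the itinerary, heights depend monotonically on the
  initial height and slopes contract backwards, so the two-letter coding carries all the entropy.

  A measure of entropy \<open>ln 2\<close> would make the letters independent and uniform, but then the reflected walk
  is null recurrent and forces the mass into the segment \<open>y = 0\<close>, where nothing happens.  If the halving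
  branch has probability \<open>p < 1/2\<close> instead, the walk has a geometric stationary distribution, and the
  entropy tends to \<open>ln 2\<close> as \<open>p\<close> tends to \<open>1/2\<close>.
\<close>

section \<open>Entropy of finite-valued functions\<close>

text \<open>In terms of the slope \<open>s = x / y\<close>, the branches below the cut-off are
  \<open>4 s\<close> on \<open>[0, 1/4]\<close> and \<open>2 (1 - s)\<close> on
  \<open>[1/2, 1]\<close>. Both are onto \<open>[0, 1]\<close>, and the gap between them leaves room
  to interpolate continuously between halving and doubling the height. The obstacle is that a
  two-letter word does not determine the heights, so the partition by \<open>low\<close> is no
  generator. Order replaces separation: orbits with a common word never exchange the order of their
  heights, so a whole profile of rounded heights is pinned down by its sum, and one word carries
  only polynomially many profiles. The region outside the two branches costs another polynomial
  factor, because an orbit meets it at most once. This one count serves both the topological and the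
  measure-theoretic upper bound. Nonexistence is quantitative: words ending below a fixed level
  number at most a constant times \<open>2^n / sqrt n\<close>, and the missing factor shows up as an
  entropy deficit. The topological lower bound counts words that stay below a level
  \<open>K\<close>, because only at bounded level are the two branches a fixed distance
  apart.\<close>

lemma gibbs_inequality:
  fixes p q :: "'i \<Rightarrow> real"
  assumes "\<And>i. i \<in> I \<Longrightarrow> 0 \<le> p i" "\<And>i. i \<in> I \<Longrightarrow> 0 \<le> q i"
    and "\<And>i. i \<in> I \<Longrightarrow> 0 < p i \<Longrightarrow> 0 < q i"
    and "sum q I \<le> sum p I"
  shows "- (\<Sum>i\<in>I. p i * ln (p i)) \<le> - (\<Sum>i\<in>I. p i * ln (q i))"
proof -
  \<comment> \<open>This is \<open>ln t \<le> t - 1\<close> at \<open>t = q i / p i\<close>. Only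
    the total masses are compared after summation, so \<open>q\<close> may have less mass than
    \<open>p\<close>, as a product of marginals restricted to the joint range has.\<close>
  have "p i * ln (q i) - p i * ln (p i) \<le> q i - p i" if "i \<in> I" for i
  proof (cases "p i = 0")
    case False
    with assms that have pq: "0 < p i" "0 < q i" by (force simp: less_le)+
    have "p i * (ln (q i) - ln (p i)) = p i * ln (q i / p i)"
      using pq by (simp add: ln_div)
    also have "\<dots> \<le> p i * (q i / p i - 1)"
      using pq by (intro mult_left_mono ln_le_minus_one) auto
    also have "\<dots> = q i - p i" using pq by (simp add: field_simps)
    finally show ?thesis by (simp add: algebra_simps)
  qed (use assms that in auto)
  then have "(\<Sum>i\<in>I. p i * ln (q i) - p i * ln (p i)) \<le> (\<Sum>i\<in>I. q i - p i)"
    by (intro sum_mono)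
  with assms(4) show ?thesis by (simp add: sum_subtractf)
qed

context prob_space
begin

definition prob_eq :: "('a \<Rightarrow> 'b) \<Rightarrow> 'b \<Rightarrow> real" where
  "prob_eq X v = prob (X -` {v} \<inter> space M)"

text \<open>Entropy is attached to functions rather than to partitions, so that a join becomes a
  pair and a coarsening becomes a composition.\<close>

definition shannon :: "('a \<Rightarrow> 'b) \<Rightarrow> real" where
  "shannon X = - (\<Sum>v\<in>X ` space M. prob_eq X v * ln (prob_eq X v))"

lemma prob_eq_nonneg [simp]: "0 \<le> prob_eq X v" and prob_eq_le_1 [simp]: "prob_eq X v \<le> 1"
  by (simp_all add: prob_eq_def)

lemma prob_eq_image:
  assumes "simple_function M Z"
  shows "prob_eq (\<lambda>x. f (Z x)) v = (\<Sum>z\<in>{z \<in> Z ` space M. f z = v}. prob_eq Z z)"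
proof -
  have "(\<lambda>x. f (Z x)) -` {v} \<inter> space M = (\<Union>z\<in>{z \<in> Z ` space M. f z = v}. Z -` {z} \<inter> space M)"
    by auto
  moreover have "prob \<dots> = (\<Sum>z\<in>{z \<in> Z ` space M. f z = v}. prob (Z -` {z} \<inter> space M))"
    using assms by (intro finite_measure_finite_Union)
      (auto simp: disjoint_family_on_def simple_function_def)
  ultimately show ?thesis by (simp add: prob_eq_def)
qed

lemma sum_prob_eq_image:
  assumes "simple_function M Z"
  shows "(\<Sum>z\<in>Z ` space M. prob_eq Z z * F (f z)) =
    (\<Sum>v\<in>(\<lambda>x. f (Z x)) ` space M. prob_eq (\<lambda>x. f (Z x)) v * F v)"
proof -
  have fin: "finite (Z ` space M)" using assms by (simp add: simple_function_def)
  have "(\<Sum>z\<in>Z ` space M. prob_eq Z z * F (f z)) =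
    (\<Sum>v\<in>f ` Z ` space M. \<Sum>z\<in>{z \<in> Z ` space M. f z = v}. prob_eq Z z * F (f z))"
    using fin by (rule sum.image_gen)
  also have "\<dots> = (\<Sum>v\<in>f ` Z ` space M. prob_eq (\<lambda>x. f (Z x)) v * F v)"
    by (intro sum.cong) (auto simp: prob_eq_image[OF assms] sum_distrib_right)
  finally show ?thesis by (simp add: image_image)
qed

lemma sum_prob_eq:
  assumes "simple_function M Z"
  shows "(\<Sum>z\<in>Z ` space M. prob_eq Z z) = 1"
proof -
  have "(\<lambda>x. True) ` space M = {True}" using not_empty by auto
  moreover have "prob_eq (\<lambda>x. True) True = 1" by (simp add: prob_eq_def prob_space)
  ultimately show ?thesis
    using sum_prob_eq_image[OF assms, of "\<lambda>_. 1" "\<lambda>_. True"] by simp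
qed

lemma prob_eq_image_ge:
  assumes "simple_function M Z" "z \<in> Z ` space M"
  shows "prob_eq Z z \<le> prob_eq (\<lambda>x. f (Z x)) (f z)"
  unfolding prob_eq_image[OF assms(1)] using assms
  by (intro member_le_sum) (auto simp: simple_function_def)

text \<open>The map \<open>f\<close> merges fibres of \<open>Z\<close>; each fibre has at most the
  probability of the merged one, and \<open>ln\<close> is monotone.\<close>

lemma shannon_data_processing:
  assumes "simple_function M Z"
  shows "shannon (\<lambda>x. f (Z x)) \<le> shannon Z"
proof -
  have "(\<Sum>z\<in>Z ` space M. prob_eq Z z * ln (prob_eq Z z)) \<le>
    (\<Sum>z\<in>Z ` space M. prob_eq Z z * ln (prob_eq (\<lambda>x. f (Z x)) (f z)))"
  proof (intro sum_mono)
    fix z assume z: "z \<in> Z ` space M"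
    show "prob_eq Z z * ln (prob_eq Z z) \<le> prob_eq Z z * ln (prob_eq (\<lambda>x. f (Z x)) (f z))"
    proof (cases "prob_eq Z z = 0")
      case False
      then have "0 < prob_eq Z z" by (simp add: less_le)
      with prob_eq_image_ge[OF assms z, of f] show ?thesis by (intro mult_left_mono) auto
    qed simp
  qed
  then show ?thesis unfolding shannon_def
    by (subst (asm) sum_prob_eq_image[OF assms, of "\<lambda>v. ln (prob_eq (\<lambda>x. f (Z x)) v)"]) simp
qed

lemma shannon_cong:
  assumes "\<And>x. x \<in> space M \<Longrightarrow> X x = Y x"
  shows "shannon X = shannon Y"
proof -
  have "X ` space M = Y ` space M" using assms by auto
  moreover have "X -` {v} \<inter> space M = Y -` {v} \<inter> space M" for v using assms by auto
  ultimately show ?thesis by (simp add: shannon_def prob_eq_def)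
qed

lemma shannon_le_of_factor:
  assumes "simple_function M Z" and "\<And>x y. x \<in> space M \<Longrightarrow> y \<in> space M \<Longrightarrow> Z x = Z y \<Longrightarrow> X x = X y"
  shows "shannon X \<le> shannon Z"
proof -
  define f where "f z = X (SOME x. x \<in> space M \<and> Z x = z)" for z
  have "f (Z x) = X x" if "x \<in> space M" for x
    unfolding f_def using that assms(2)
    by (metis (mono_tags, lifting) someI_ex)
  then have "shannon X = shannon (\<lambda>x. f (Z x))" by (intro shannon_cong) simp
  with shannon_data_processing[OF assms(1)] show ?thesis by simp
qed

text \<open>Gibbs' inequality against the product of the marginals, whose mass on the joint range is
  at most 1.\<close>

lemma shannon_Pair_le:
  assumes "simple_function M X" "simple_function M Y"
  shows "shannon (\<lambda>x. (X x, Y x)) \<le> shannon X + shannon Y"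
proof -
  let ?Z = "\<lambda>x. (X x, Y x)"
  let ?q = "\<lambda>z. prob_eq X (fst z) * prob_eq Y (snd z)"
  note Z = simple_function_Pair[OF assms]
  have marg: "prob_eq ?Z z \<le> prob_eq X (fst z)" "prob_eq ?Z z \<le> prob_eq Y (snd z)"
    if "z \<in> ?Z ` space M" for z
    using prob_eq_image_ge[OF Z that, of fst] prob_eq_image_ge[OF Z that, of snd] by simp_all
  have fin: "finite (X ` space M)" "finite (Y ` space M)" using assms by (auto simp: simple_function_def)
  have "sum ?q (?Z ` space M) \<le> sum ?q (X ` space M \<times> Y ` space M)"
    using fin by (intro sum_mono2) auto
  also have "\<dots> = (\<Sum>v\<in>X ` space M. prob_eq X v) * (\<Sum>v\<in>Y ` space M. prob_eq Y v)"
    by (simp add: sum_product sum.cartesian_product case_prod_unfold)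
  also have "\<dots> = sum (prob_eq ?Z) (?Z ` space M)"
    by (simp add: sum_prob_eq assms Z)
  finally have "shannon ?Z \<le> - (\<Sum>z\<in>?Z ` space M. prob_eq ?Z z * ln (?q z))"
    unfolding shannon_def
  proof (intro gibbs_inequality)
    fix z assume "z \<in> ?Z ` space M" "0 < prob_eq ?Z z"
    with marg[of z] show "0 < ?q z" by simp
  qed auto
  also have "(\<Sum>z\<in>?Z ` space M. prob_eq ?Z z * ln (?q z)) =
    (\<Sum>z\<in>?Z ` space M. prob_eq ?Z z * ln (prob_eq X (fst z))) +
    (\<Sum>z\<in>?Z ` space M. prob_eq ?Z z * ln (prob_eq Y (snd z)))"
    unfolding sum.distrib[symmetric]
  proof (intro sum.cong refl)
    fix z assume z: "z \<in> ?Z ` space M"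
    show "prob_eq ?Z z * ln (?q z) =
      prob_eq ?Z z * ln (prob_eq X (fst z)) + prob_eq ?Z z * ln (prob_eq Y (snd z))"
    proof (cases "prob_eq ?Z z = 0")
      case False
      then have "0 < prob_eq ?Z z" by (simp add: less_le)
      with marg[OF z] have "0 < prob_eq X (fst z)" "0 < prob_eq Y (snd z)" by linarith+
      then show ?thesis by (simp add: ln_mult distrib_left)
    qed simp
  qed
  also have "- \<dots> = shannon X + shannon Y"
    using sum_prob_eq_image[OF Z, of "\<lambda>v. ln (prob_eq X v)" fst]
      sum_prob_eq_image[OF Z, of "\<lambda>v. ln (prob_eq Y v)" snd]
    by (simp add: shannon_def)
  finally show ?thesis .
qed

text \<open>The sum bounds the conditional entropy of \<open>X\<close> given \<open>V\<close>. The
  comparison weight in Gibbs' inequality spreads the probability of each fibre of \<open>V\<close>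
  evenly over \<open>N v\<close> places.\<close>

lemma shannon_le_card_fibres:
  assumes "simple_function M X" "simple_function M V"
    and "\<And>v. v \<in> V ` space M \<Longrightarrow> real (card (X ` (V -` {v} \<inter> space M))) \<le> N v"
  shows "shannon X \<le> shannon V + (\<Sum>v\<in>V ` space M. prob_eq V v * ln (N v))"
proof -
  let ?Z = "\<lambda>x. (X x, V x)"
  let ?q = "\<lambda>z. prob_eq V (snd z) / N (snd z)"
  note Z = simple_function_Pair[OF assms(1,2)]
  have fin: "finite (X ` space M)" "finite (V ` space M)" using assms by (auto simp: simple_function_def)
  have N: "1 \<le> N v" if "v \<in> V ` space M" for v
  proof -
    have "finite (X ` (V -` {v} \<inter> space M))" using fin(1) by (rule rev_finite_subset) auto
    moreover have "X ` (V -` {v} \<inter> space M) \<noteq> {}" using that by auto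
    ultimately have "0 < card (X ` (V -` {v} \<inter> space M))" by (simp add: card_gt_0_iff)
    then show ?thesis using assms(3)[OF that] by linarith
  qed
  have marg: "prob_eq ?Z z \<le> prob_eq V (snd z)" if "z \<in> ?Z ` space M" for z
    using prob_eq_image_ge[OF Z that, of snd] by simp
  have "sum ?q (?Z ` space M) = (\<Sum>v\<in>snd ` ?Z ` space M. \<Sum>z\<in>{z \<in> ?Z ` space M. snd z = v}. ?q z)"
    using Z by (intro sum.image_gen) (simp add: simple_function_def)
  also have "snd ` ?Z ` space M = V ` space M" by force
  also have "(\<Sum>v\<in>V ` space M. \<Sum>z\<in>{z \<in> ?Z ` space M. snd z = v}. ?q z) \<le> (\<Sum>v\<in>V ` space M. prob_eq V v)"
  proof (intro sum_mono)
    fix v assume v: "v \<in> V ` space M"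
    have "{z \<in> ?Z ` space M. snd z = v} = (\<lambda>x. (x, v)) ` (X ` (V -` {v} \<inter> space M))" by auto
    then have c: "card {z \<in> ?Z ` space M. snd z = v} = card (X ` (V -` {v} \<inter> space M))"
      by (simp add: card_image inj_on_def)
    have "(\<Sum>z\<in>{z \<in> ?Z ` space M. snd z = v}. ?q z) = (\<Sum>z\<in>{z \<in> ?Z ` space M. snd z = v}. prob_eq V v / N v)"
      by (intro sum.cong) auto
    also have "\<dots> = real (card {z \<in> ?Z ` space M. snd z = v}) * (prob_eq V v / N v)" by simp
    also have "\<dots> \<le> N v * (prob_eq V v / N v)"
      unfolding c using N[OF v] assms(3)[OF v] by (intro mult_right_mono) auto
    also have "\<dots> = prob_eq V v" using N[OF v] by simp
    finally show "(\<Sum>z\<in>{z \<in> ?Z ` space M. snd z = v}. ?q z) \<le> prob_eq V v" .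
  qed
  also have "\<dots> = sum (prob_eq ?Z) (?Z ` space M)" by (simp add: sum_prob_eq assms Z)
  finally have "shannon ?Z \<le> - (\<Sum>z\<in>?Z ` space M. prob_eq ?Z z * ln (?q z))"
    unfolding shannon_def
  proof (intro gibbs_inequality)
    fix z assume z: "z \<in> ?Z ` space M"
    then have "1 \<le> N (snd z)" by (intro N) auto
    then show "0 \<le> ?q z" by simp
    assume "0 < prob_eq ?Z z"
    with marg[OF z] \<open>1 \<le> N (snd z)\<close> show "0 < ?q z" by simp
  qed auto
  also have "(\<Sum>z\<in>?Z ` space M. prob_eq ?Z z * ln (?q z)) =
    (\<Sum>z\<in>?Z ` space M. prob_eq ?Z z * (ln (prob_eq V (snd z)) - ln (N (snd z))))"
  proof (intro sum.cong refl)
    fix z assume z: "z \<in> ?Z ` space M"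
    show "prob_eq ?Z z * ln (?q z) = prob_eq ?Z z * (ln (prob_eq V (snd z)) - ln (N (snd z)))"
    proof (cases "prob_eq ?Z z = 0")
      case False
      then have "0 < prob_eq ?Z z" by (simp add: less_le)
      with marg[OF z] have "0 < prob_eq V (snd z)" by linarith
      moreover have "1 \<le> N (snd z)" using z by (intro N) auto
      ultimately show ?thesis by (simp add: ln_div)
    qed simp
  qed
  also have "\<dots> = (\<Sum>v\<in>V ` space M. prob_eq V v * (ln (prob_eq V v) - ln (N v)))"
    using sum_prob_eq_image[OF Z, of "\<lambda>v. ln (prob_eq V v) - ln (N v)" snd] by simp
  also have "- \<dots> = shannon V + (\<Sum>v\<in>V ` space M. prob_eq V v * ln (N v))"
    by (simp add: shannon_def right_diff_distrib sum_subtractf)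
  finally have "shannon ?Z \<le> shannon V + (\<Sum>v\<in>V ` space M. prob_eq V v * ln (N v))" .
  moreover have "shannon X \<le> shannon ?Z"
    using shannon_data_processing[OF Z, of fst] by simp
  ultimately show ?thesis by simp
qed

lemma shannon_le_ln_card_fibres:
  assumes "simple_function M X" "simple_function M V"
    and "\<And>v. v \<in> V ` space M \<Longrightarrow> real (card (X ` (V -` {v} \<inter> space M))) \<le> N"
  shows "shannon X \<le> shannon V + ln N"
  using shannon_le_card_fibres[OF assms(1,2), of "\<lambda>_. N"] assms(3) sum_prob_eq[OF assms(2)]
  by (simp add: sum_distrib_right[symmetric])

lemma shannon_le_ln_card:
  assumes "simple_function M X" "real (card (X ` space M)) \<le> N"
  shows "shannon X \<le> ln N"
proof -
  have "(\<lambda>x. True) ` space M = {True}" using not_empty by auto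
  moreover have "prob_eq (\<lambda>x. True) True = 1" by (simp add: prob_eq_def prob_space)
  ultimately have "shannon (\<lambda>x. True) = 0" by (simp add: shannon_def)
  moreover have "card (X ` ((\<lambda>x. True) -` {v} \<inter> space M)) \<le> card (X ` space M)" for v
    using assms(1) by (intro card_mono) (auto simp: simple_function_def)
  ultimately show ?thesis
    using shannon_le_ln_card_fibres[OF assms(1), of "\<lambda>_. True" N] assms(2) by fastforce
qed

lemma shannon_nonneg: "0 \<le> shannon X"
proof -
  have "prob_eq X v * ln (prob_eq X v) \<le> 0" for v
    by (cases "prob_eq X v = 0") (auto intro!: mult_nonneg_nonpos simp: less_le)
  then show ?thesis by (simp add: shannon_def sum_nonpos)
qed

lemma prob_eq_notin: "v \<notin> X ` space M \<Longrightarrow> prob_eq X v = 0"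
proof -
  assume "v \<notin> X ` space M"
  then have "X -` {v} \<inter> space M = {}" by auto
  then show ?thesis by (simp add: prob_eq_def)
qed

text \<open>The term \<open>ln 2\<close> pays for knowing the bit \<open>V\<close>. The estimate is
  meant for an event on which \<open>X\<close> is known to take few values, set against a trivial
  count on its complement.\<close>

lemma shannon_le_two_fibres:
  fixes V :: "'a \<Rightarrow> bool"
  assumes X: "simple_function M X" and V: "simple_function M V"
    and a: "card (X ` {x \<in> space M. V x}) \<le> a" and b: "card (X ` {x \<in> space M. \<not> V x}) \<le> b"
  shows "shannon X \<le> ln 2 + prob {x \<in> space M. V x} * ln (real a) + (1 - prob {x \<in> space M. V x}) * ln (real b)"
proof -
  let ?N = "\<lambda>v. if v then real a else real b"
  have sets: "V -` {True} \<inter> space M \<in> sets M" using V by (rule simple_functionD)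
  have eq: "V -` {True} \<inter> space M = {x \<in> space M. V x}" "V -` {False} \<inter> space M = {x \<in> space M. \<not> V x}"
    by auto
  have "prob (space M - {x \<in> space M. V x}) = 1 - prob {x \<in> space M. V x}"
    using sets unfolding eq by (rule prob_compl)
  moreover have "space M - {x \<in> space M. V x} = {x \<in> space M. \<not> V x}" by auto
  ultimately have p: "prob_eq V True = prob {x \<in> space M. V x}" "prob_eq V False = 1 - prob {x \<in> space M. V x}"
    unfolding prob_eq_def eq by simp_all
  have "shannon X \<le> shannon V + (\<Sum>v\<in>V ` space M. prob_eq V v * ln (?N v))"
  proof (rule shannon_le_card_fibres[OF X V])
    fix v show "real (card (X ` (V -` {v} \<inter> space M))) \<le> ?N v"
      using a b by (cases v) (simp_all add: eq)
  qed
  also have "(\<Sum>v\<in>V ` space M. prob_eq V v * ln (?N v)) = (\<Sum>v\<in>UNIV. prob_eq V v * ln (?N v))"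
    by (rule sum.mono_neutral_left) (auto simp: prob_eq_notin)
  also have "\<dots> = prob {x \<in> space M. V x} * ln (real a) + (1 - prob {x \<in> space M. V x}) * ln (real b)"
    by (simp add: UNIV_bool p)
  also have "shannon V \<le> ln 2"
  proof (rule shannon_le_ln_card[OF V])
    have "card (V ` space M) \<le> card (UNIV :: bool set)" by (rule card_mono) auto
    then show "real (card (V ` space M)) \<le> 2" by simp
  qed
  finally show ?thesis by simp
qed

end

section \<open>Measure-preserving maps and itineraries\<close>

definition itinerary :: "('a \<Rightarrow> 'a) \<Rightarrow> ('a \<Rightarrow> 'b) \<Rightarrow> nat \<Rightarrow> 'a \<Rightarrow> 'b list" where
  "itinerary T c n x = map (\<lambda>k. c ((T ^^ k) x)) [0..<n]"

definition cell_of :: "'a set set \<Rightarrow> 'a \<Rightarrow> 'a set" where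
  "cell_of P x = (THE A. A \<in> P \<and> x \<in> A)"

lemma length_itinerary [simp]: "length (itinerary T c n x) = n"
  by (simp add: itinerary_def)

lemma itinerary_0 [simp]: "itinerary T c 0 x = []"
  by (simp add: itinerary_def)

lemma itinerary_Suc: "itinerary T c (Suc n) x = itinerary T c n x @ [c ((T ^^ n) x)]"
  by (simp add: itinerary_def)

lemma nth_itinerary [simp]: "k < n \<Longrightarrow> itinerary T c n x ! k = c ((T ^^ k) x)"
  by (simp add: itinerary_def)

lemma itinerary_eq_iff:
  "itinerary T c n x = itinerary T c n y \<longleftrightarrow> (\<forall>k<n. c ((T ^^ k) x) = c ((T ^^ k) y))"
  by (auto simp: itinerary_def)

lemma itinerary_add: "itinerary T c (a + b) x = itinerary T c a x @ itinerary T c b ((T ^^ a) x)"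
proof (induction b)
  case (Suc b)
  have "(T ^^ (a + b)) x = (T ^^ b) ((T ^^ a) x)" by (subst add.commute) (simp add: funpow_add)
  with Suc show ?case by (simp add: itinerary_Suc)
qed simp

lemma itinerary_shift_eq:
  assumes "itinerary T c n x = itinerary T c n y" "k + J \<le> n"
  shows "itinerary T c J ((T ^^ k) x) = itinerary T c J ((T ^^ k) y)"
  unfolding itinerary_eq_iff
proof (intro allI impI)
  fix j assume "j < J"
  with assms(2) have "j + k < n" by simp
  with assms(1) have "c ((T ^^ (j + k)) x) = c ((T ^^ (j + k)) y)" by (simp add: itinerary_eq_iff)
  then show "c ((T ^^ j) ((T ^^ k) x)) = c ((T ^^ j) ((T ^^ k) y))" by (simp add: funpow_add)
qed

lemma finite_itineraries:
  assumes "finite (c ` S)" "T ` S \<subseteq> S" shows "finite (itinerary T c n ` S)"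
proof -
  have "(T ^^ k) x \<in> S" if "x \<in> S" for k x
    using that assms(2) by (induction k) auto
  then have "itinerary T c n ` S \<subseteq> {w. set w \<subseteq> c ` S \<and> length w = n}"
    by (auto simp: itinerary_def)
  then show ?thesis using finite_lists_length_eq[OF assms(1)] by (rule finite_subset)
qed

lemma cell_of_eq:
  assumes "partition_on S P" "A \<in> P" "x \<in> A"
  shows "cell_of P x = A"
  unfolding cell_of_def using assms
  by (intro the_equality) (auto simp: partition_on_def disjoint_def)

lemma cell_of_mem:
  assumes "partition_on S P" "x \<in> S"
  shows "cell_of P x \<in> P" "x \<in> cell_of P x"
proof -
  obtain A where "A \<in> P" "x \<in> A" using assms by (auto simp: partition_on_def)
  with cell_of_eq[OF assms(1)] show "cell_of P x \<in> P" "x \<in> cell_of P x" by auto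
qed

lemma simple_function_cell_of:
  assumes "finite_measurable_partition M P"
  shows "simple_function M (cell_of P)"
proof -
  have P: "partition_on (space M) P" "finite P" "P \<subseteq> sets M"
    using assms by (auto simp: finite_measurable_partition_def)
  have "cell_of P -` {A} \<inter> space M = A" if "A \<in> P" for A
    using that P cell_of_eq[OF P(1)] cell_of_mem[OF P(1)] by (fastforce dest: sets.sets_into_space)
  moreover have "cell_of P ` space M \<subseteq> P" using cell_of_mem[OF P(1)] by auto
  ultimately show ?thesis
    using P cell_of_mem(1)[OF P(1)] finite_subset[of "cell_of P ` space M" P]
    by (auto simp: simple_function_def subset_eq)
qed

text \<open>Bridge from joins of sets to itineraries. The empty set is removed because a fibre over
  an attained word is never empty.\<close>

lemma refined_partition_eq:
  assumes "finite_measurable_partition M P" and T: "T \<in> measurable M M"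
  shows "refined_partition M T P n - {{}} =
    (\<lambda>w. itinerary T (cell_of P) n -` {w} \<inter> space M) ` itinerary T (cell_of P) n ` space M"
proof (induction n)
  case (Suc n)
  have P: "partition_on (space M) P" using assms by (simp add: finite_measurable_partition_def)
  have TS: "(T ^^ n) x \<in> space M" if "x \<in> space M" for x
    using measurable_space[OF measurable_compose_n[OF T, of n] that] .
  let ?F = "\<lambda>n w. itinerary T (cell_of P) n -` {w} \<inter> space M"
  have cell: "cell_of P ((T ^^ n) x) = B \<longleftrightarrow> (T ^^ n) x \<in> B" if "x \<in> space M" "B \<in> P" for x B
    using cell_of_eq[OF P that(2)] cell_of_mem[OF P TS[OF that(1)]] by auto
  have step: "?F n w \<inter> ((T ^^ n) -` B \<inter> space M) = ?F (Suc n) (w @ [B])" if "B \<in> P" for w B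
    using cell[OF _ that] by (auto simp: itinerary_Suc)
  show ?case
  proof (intro equalityI subsetI)
    fix A assume "A \<in> refined_partition M T P (Suc n) - {{}}"
    then obtain A' B where A: "A = A' \<inter> ((T ^^ n) -` B \<inter> space M)" "A' \<in> refined_partition M T P n"
      "B \<in> P" "A \<noteq> {}" by auto
    then have "A' \<in> refined_partition M T P n - {{}}" by auto
    then obtain w where "A' = ?F n w" unfolding Suc by auto
    with A step have eq: "A = ?F (Suc n) (w @ [B])" by simp
    with A(4) obtain x where "x \<in> space M" "w @ [B] = itinerary T (cell_of P) (Suc n) x" by (auto dest: sym)
    then have "w @ [B] \<in> itinerary T (cell_of P) (Suc n) ` space M" by (simp only: image_eqI)
    then show "A \<in> ?F (Suc n) ` itinerary T (cell_of P) (Suc n) ` space M" unfolding eq by (rule imageI)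
  next
    fix A assume "A \<in> ?F (Suc n) ` itinerary T (cell_of P) (Suc n) ` space M"
    then obtain x where x: "x \<in> space M" "A = ?F (Suc n) (itinerary T (cell_of P) (Suc n) x)" by auto
    let ?B = "cell_of P ((T ^^ n) x)" and ?A = "?F n (itinerary T (cell_of P) n x)"
    have B: "?B \<in> P" using cell_of_mem[OF P TS[OF x(1)]] by simp
    have "?A \<in> refined_partition M T P n" using Suc x(1) by blast
    moreover have "A = ?A \<inter> ((T ^^ n) -` ?B \<inter> space M)"
      unfolding step[OF B] x(2) by (simp only: itinerary_Suc)
    moreover have "x \<in> A" using x by simp
    ultimately show "A \<in> refined_partition M T P (Suc n) - {{}}" using B by auto
  qed
qed auto

lemma finite_refined_partition: "finite P \<Longrightarrow> finite (refined_partition M T P n)"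
proof (induction n)
  case (Suc n)
  have "refined_partition M T P (Suc n) \<subseteq>
    (\<lambda>(A, B). A \<inter> ((T ^^ n) -` B \<inter> space M)) ` (refined_partition M T P n \<times> P)" by auto
  with Suc show ?case by (meson finite_SigmaI finite_imageI finite_subset)
qed simp

text \<open>Controls the entropy contributed by sets of small probability: a set of mass at most
  \<open>r\<^sup>2\<close> contributes at most \<open>2 * r\<close>.\<close>

lemma minus_xlnx_le_sqrt:
  fixes t :: real assumes "0 \<le> t" shows "- (t * ln t) \<le> 2 * sqrt t"
proof (cases "t = 0")
  case False
  with assms have t: "0 < t" by simp
  have "ln (inverse (sqrt t)) \<le> inverse (sqrt t) - 1" using t by (intro ln_le_minus_one) simp
  then have "- ln t \<le> 2 * inverse (sqrt t)" using t by (simp add: ln_inverse ln_sqrt)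
  then have "t * (- ln t) \<le> t * (2 * inverse (sqrt t))" using t by (intro mult_left_mono) auto
  also have "\<dots> = 2 * sqrt t" using t by (simp add: field_simps)
  finally show ?thesis by simp
qed simp

text \<open>Controls the entropy contributed by a set of almost full probability.\<close>

lemma minus_xlnx_le:
  fixes t :: real assumes "0 \<le> t" shows "- (t * ln t) \<le> 1 - t"
proof (cases "t = 0")
  case False
  with assms have t: "0 < t" by simp
  have "ln (inverse t) \<le> inverse t - 1" using t by (intro ln_le_minus_one) simp
  then have "t * (- ln t) \<le> t * (inverse t - 1)" using t by (intro mult_left_mono) (auto simp: ln_inverse)
  also have "\<dots> = 1 - t" using t by (simp add: field_simps)
  finally show ?thesis by simp
qed simp

locale mpt = prob_space M for M :: "'a measure" +
  fixes T :: "'a \<Rightarrow> 'a"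
  assumes measurable_T [measurable]: "T \<in> measurable M M" and distr_T: "distr M M T = M"
begin

lemma measurable_T_pow: "(T ^^ k) \<in> measurable M M"
  by (rule measurable_compose_n) simp

lemma T_pow_space: "x \<in> space M \<Longrightarrow> (T ^^ k) x \<in> space M"
  using measurable_T_pow by (rule measurable_space)

lemma distr_T_pow: "distr M M (T ^^ k) = M"
proof (induction k)
  case (Suc k)
  have "distr M M (T ^^ Suc k) = distr (distr M M (T ^^ k)) M T"
    by (simp only: distr_distr[OF measurable_T measurable_T_pow] funpow.simps)
  with Suc distr_T show ?case by (simp only:)
qed (simp add: distr_id[unfolded id_def] id_def)

lemma prob_T_pow: "A \<in> sets M \<Longrightarrow> prob ((T ^^ k) -` A \<inter> space M) = prob A"
  using measure_distr[OF measurable_T_pow[of k], of A] by (simp add: distr_T_pow)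

lemma simple_function_T_pow:
  assumes "simple_function M c" shows "simple_function M (\<lambda>x. c ((T ^^ k) x))"
  using simple_function_comp[OF measurable_T_pow assms] by simp

lemma shannon_T_pow:
  assumes "simple_function M c" shows "shannon (\<lambda>x. c ((T ^^ k) x)) = shannon c"
proof -
  have sets: "c -` {v} \<inter> space M \<in> sets M" for v using assms by (rule simple_functionD)
  have "(\<lambda>x. c ((T ^^ k) x)) -` {v} \<inter> space M = (T ^^ k) -` (c -` {v} \<inter> space M) \<inter> space M" for v
    using T_pow_space by auto
  then have eq: "prob_eq (\<lambda>x. c ((T ^^ k) x)) v = prob_eq c v" for v
    using prob_T_pow[OF sets] by (simp add: prob_eq_def)
  have sub: "(\<lambda>x. c ((T ^^ k) x)) ` space M \<subseteq> c ` space M" using T_pow_space by auto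
  have "prob_eq (\<lambda>x. c ((T ^^ k) x)) v = 0" if "v \<notin> (\<lambda>x. c ((T ^^ k) x)) ` space M" for v
  proof -
    have "(\<lambda>x. c ((T ^^ k) x)) -` {v} \<inter> space M = {}" using that by auto
    then show ?thesis by (simp add: prob_eq_def)
  qed
  then have "(\<Sum>v\<in>(\<lambda>x. c ((T ^^ k) x)) ` space M. prob_eq c v * ln (prob_eq c v)) =
      (\<Sum>v\<in>c ` space M. prob_eq c v * ln (prob_eq c v))"
    using assms sub by (intro sum.mono_neutral_left) (auto simp: simple_function_def eq)
  then show ?thesis by (simp add: shannon_def eq)
qed

lemma simple_function_itinerary:
  assumes "simple_function M c" shows "simple_function M (itinerary T c n)"
proof (induction n)
  case (Suc n)
  have "simple_function M (\<lambda>x. (\<lambda>(w, b). w @ [b]) (itinerary T c n x, c ((T ^^ n) x)))"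
    using simple_function_compose1[OF simple_function_Pair[OF Suc simple_function_T_pow[OF assms, of n]]] .
  then show ?case by (simp add: itinerary_Suc[abs_def])
qed (simp add: itinerary_def[abs_def])

lemma shannon_itinerary_add:
  assumes "simple_function M c"
  shows "shannon (itinerary T c (a + b)) \<le> shannon (itinerary T c a) + shannon (itinerary T c b)"
proof -
  let ?b = "\<lambda>x. itinerary T c b ((T ^^ a) x)"
  note s = simple_function_itinerary[OF assms]
  have b: "simple_function M ?b" by (rule simple_function_T_pow[OF s])
  have "shannon (itinerary T c (a + b)) \<le> shannon (\<lambda>x. (itinerary T c a x, ?b x))"
    using s b by (intro shannon_le_of_factor simple_function_Pair) (auto simp: itinerary_add)
  also have "\<dots> \<le> shannon (itinerary T c a) + shannon ?b"
    by (rule shannon_Pair_le[OF s b])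
  finally show ?thesis by (simp add: shannon_T_pow[OF s])
qed

lemma shannon_itinerary_mult:
  assumes "simple_function M c"
  shows "shannon (itinerary T c (k * n)) \<le> real n * shannon (itinerary T c k)"
proof (induction n)
  case 0
  have "itinerary T c 0 = (\<lambda>_. [])" by auto
  moreover have "shannon (\<lambda>_. []) \<le> ln 1"
    by (rule shannon_le_ln_card) (simp_all add: image_constant_conv)
  ultimately show ?case by simp
next
  case (Suc n)
  then show ?case using shannon_itinerary_add[OF assms, of k "k * n"] by (simp add: algebra_simps)
qed

lemma shannon_itinerary_le:
  assumes "simple_function M c"
  shows "shannon (itinerary T c n) \<le> real n * shannon c"
proof -
  have "shannon (itinerary T c 1) \<le> shannon c"
    by (rule shannon_le_of_factor[OF assms]) (simp add: itinerary_def)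
  then have "real n * shannon (itinerary T c 1) \<le> real n * shannon c" by (intro mult_left_mono) auto
  with shannon_itinerary_mult[OF assms, of 1 n] show ?thesis by simp
qed

lemma partition_entropy_eq_shannon:
  assumes "finite_measurable_partition M P"
  shows "partition_entropy M (refined_partition M T P n) = shannon (itinerary T (cell_of P) n)"
proof -
  let ?F = "\<lambda>w. itinerary T (cell_of P) n -` {w} \<inter> space M"
  have fin: "finite (refined_partition M T P n)"
    using assms by (intro finite_refined_partition) (simp add: finite_measurable_partition_def)
  have "partition_entropy M (refined_partition M T P n) =
    - (\<Sum>A\<in>refined_partition M T P n - {{}}. prob A * ln (prob A))"
    unfolding partition_entropy_def using fin
    by (intro arg_cong[of _ _ uminus] sum.mono_neutral_right) auto
  also have "\<dots> = shannon (itinerary T (cell_of P) n)"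
    unfolding refined_partition_eq[OF assms measurable_T] shannon_def prob_eq_def
    by (subst sum.reindex) (auto simp: inj_on_def)
  finally show ?thesis .
qed

section \<open>Entropy rate of a finite coding\<close>

definition rate :: "('a \<Rightarrow> 'b) \<Rightarrow> ereal" where
  "rate c = limsup (\<lambda>n. ereal (shannon (itinerary T c n) / real n))"

lemma ks_entropy_partition_eq_rate:
  "finite_measurable_partition M P \<Longrightarrow> ks_entropy_partition M T P = rate (cell_of P)"
  by (simp add: ks_entropy_partition_def rate_def partition_entropy_eq_shannon)

lemma rate_le_add:
  assumes "\<And>n. shannon (itinerary T c n) \<le> shannon (itinerary T d n) + r n"
    and "(\<lambda>n. r n / real n) \<longlonglongrightarrow> e"
  shows "rate c \<le> rate d + ereal e"
proof -
  have "rate c \<le> limsup (\<lambda>n. ereal (shannon (itinerary T d n) / real n) + ereal (r n / real n))"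
    unfolding rate_def using assms(1)
    by (intro Limsup_mono always_eventually) (simp add: add_divide_distrib[symmetric] divide_right_mono)
  also have "\<dots> = rate d + ereal e"
    unfolding rate_def using assms(2)
    by (subst add.commute, subst ereal_limsup_lim_add[of _ "ereal e"]) (auto simp: add.commute)
  finally show ?thesis .
qed

text \<open>The upper half of Fekete's lemma: cut a word of length \<open>n\<close> into blocks of
  length \<open>k\<close> and a remainder, which costs at most \<open>k\<close> times
  \<open>shannon c\<close>. It also turns a full rate into full entropy at every single
  length.\<close>

lemma rate_le_shannon:
  assumes c: "simple_function M c" and k: "0 < k"
  shows "rate c \<le> ereal (shannon (itinerary T c k) / real k)"
proof -
  let ?h = "shannon (itinerary T c k)"
  have "shannon (itinerary T c n) \<le> real n * (?h / real k) + real k * shannon c" for n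
  proof -
    have "shannon (itinerary T c n) \<le> shannon (itinerary T c (k * (n div k))) + shannon (itinerary T c (n mod k))"
      using shannon_itinerary_add[OF c, of "k * (n div k)" "n mod k"] by simp
    moreover have "shannon (itinerary T c (k * (n div k))) \<le> real (n div k) * ?h"
      by (rule shannon_itinerary_mult[OF c])
    moreover have "real (n div k) * ?h \<le> real n / real k * ?h"
      using k by (intro mult_right_mono shannon_nonneg of_nat_div_le_of_nat)
    moreover have "shannon (itinerary T c (n mod k)) \<le> real (n mod k) * shannon c"
      by (rule shannon_itinerary_le[OF c])
    moreover have "real (n mod k) * shannon c \<le> real k * shannon c"
      using k by (intro mult_right_mono shannon_nonneg) (simp add: less_imp_le)
    ultimately show ?thesis by simp
  qed
  note le = this
  have "shannon (itinerary T c n) / real n \<le> ?h / real k + real k * shannon c / real n" if "0 < n" for n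
    using divide_right_mono[OF le[of n], of "real n"] that by (simp add: add_divide_distrib)
  then have "rate c \<le> limsup (\<lambda>n. ereal (?h / real k + real k * shannon c / real n))"
    unfolding rate_def by (intro Limsup_mono) (auto simp: eventually_sequentially intro!: exI[of _ 1])
  also have "(\<lambda>n. ?h / real k + real k * shannon c / real n) \<longlonglongrightarrow> ?h / real k + 0"
    by (intro tendsto_intros lim_const_over_n)
  then have "limsup (\<lambda>n. ereal (?h / real k + real k * shannon c / real n)) = ereal (?h / real k)"
    by (intro lim_imp_Limsup) auto
  finally show ?thesis .
qed

end

section \<open>Approximating arbitrary partitions\<close>

text \<open>\<open>M\<close> lives on the trace of the Borel sets on \<open>S\<close>; it is pushed
  forward along the identity to a Borel measure on the whole space, where inner regularity
  applies.\<close>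

lemma compact_inner_approx:
  fixes M :: "'a::{heine_borel, second_countable_topology} measure"
  assumes "prob_space M" "sets M = sets (restrict_space borel S)" "S \<in> sets borel"
    and A: "A \<in> sets M" and d: "0 < d"
  shows "\<exists>K\<subseteq>A. compact K \<and> K \<in> sets M \<and> measure M (A - K) < d"
proof -
  interpret prob_space M by fact
  have sub: "B \<in> sets M \<longleftrightarrow> B \<in> sets borel \<and> B \<subseteq> S" for B
    using assms(2,3) by (auto simp: sets_restrict_space_iff)
  have [measurable]: "(\<lambda>x. x) \<in> measurable M borel"
    using assms(2) measurable_restrict_space1[OF measurable_ident, of borel S]
    by (simp add: id_def cong: measurable_cong_sets)
  let ?N = "distr M borel (\<lambda>x. x)"
  have N: "emeasure ?N B = ennreal (prob B)" if "B \<in> sets M" for B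
    using that sub[of B] sets.sets_into_space[OF that]
    by (simp add: emeasure_distr emeasure_eq_measure Int_absorb2)
  have reg: "emeasure ?N A = (SUP K\<in>{K. K \<subseteq> A \<and> compact K}. emeasure ?N K)"
    using A sub by (intro inner_regular) (auto simp: emeasure_distr emeasure_eq_measure)
  show ?thesis
  proof (cases "prob A = 0")
    case True
    then show ?thesis using d by (intro exI[of _ "{}"]) auto
  next
    case False
    then have "0 < prob A" by (simp add: zero_less_measure_iff)
    then have "ennreal (prob A - d) < emeasure ?N A"
      unfolding N[OF A] using d by (intro ennreal_lessI) auto
    then obtain K where K: "K \<subseteq> A" "compact K" "ennreal (prob A - d) < emeasure ?N K"
      unfolding reg less_SUP_iff by auto
    have KM: "K \<in> sets M" unfolding sub
      using K A sub[of A] by (auto intro: borel_compact)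
    with K(3) have "ennreal (prob A - d) < ennreal (prob K)" by (simp add: N)
    then have "prob A - d < prob K" by (meson ennreal_leI leD not_le)
    then have "prob (A - K) < d" using finite_measure_Diff[OF A KM K(1)] by simp
    with K KM show ?thesis by blast
  qed
qed

lemma finite_compact_family_separated:
  fixes K :: "'i \<Rightarrow> 'a::heine_borel set"
  assumes "finite I" "\<And>i. i \<in> I \<Longrightarrow> compact (K i)"
    and "\<And>i j. i \<in> I \<Longrightarrow> j \<in> I \<Longrightarrow> i \<noteq> j \<Longrightarrow> K i \<inter> K j = {}"
  shows "\<exists>e>0. \<forall>i\<in>I. \<forall>j\<in>I. \<forall>x\<in>K i. \<forall>y\<in>K j. dist x y < e \<longrightarrow> i = j"
proof -
  have "\<exists>e>0. i \<noteq> j \<longrightarrow> (\<forall>x\<in>K i. \<forall>y\<in>K j. e \<le> dist x y)" if "i \<in> I" "j \<in> I" for i j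
  proof (cases "i = j")
    case False
    then show ?thesis
      using separate_compact_closed[of "K i" "K j"] assms(2,3) that by (auto intro: compact_imp_closed)
  qed (auto intro: exI[of _ 1])
  then obtain e where e: "\<And>i j. i \<in> I \<Longrightarrow> j \<in> I \<Longrightarrow> 0 < e i j"
    "\<And>i j x y. i \<in> I \<Longrightarrow> j \<in> I \<Longrightarrow> i \<noteq> j \<Longrightarrow> x \<in> K i \<Longrightarrow> y \<in> K j \<Longrightarrow> e i j \<le> dist x y"
    by metis
  let ?E = "insert 1 ((\<lambda>(i, j). e i j) ` (I \<times> I))"
  have fin: "finite ?E" using assms(1) by simp
  show ?thesis
  proof (intro exI[of _ "Min ?E"] conjI ballI impI)
    show "0 < Min ?E" using fin e(1) by (subst Min_gr_iff) auto
    fix i j x y assume ij: "i \<in> I" "j \<in> I" "x \<in> K i" "y \<in> K j" "dist x y < Min ?E"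
    then have "Min ?E \<le> e i j" using fin by (intro Min_le) auto
    with ij e(2)[of i j x y] show "i = j" by force
  qed
qed

text \<open>Inside each cell a compact kernel of almost full mass is chosen. Kernels of different
  cells lie a positive distance apart, so two nearby points in kernels share their cell; elsewhere
  \<open>R\<close> simply remembers the cell. As \<open>R\<close> is almost surely close to the
  constant \<open>None\<close>, its entropy is small.\<close>

lemma partition_approx:
  fixes M :: "'a::{heine_borel, second_countable_topology} measure"
  assumes "prob_space M" "sets M = sets (restrict_space borel S)" "S \<in> sets borel"
    and P: "finite_measurable_partition M P" and d: "0 < d"
  shows "\<exists>e>0. \<exists>R :: 'a \<Rightarrow> 'a set option. simple_function M R \<and> prob_space.shannon M R \<le> d \<and>
    (\<forall>x\<in>space M. \<forall>y\<in>space M. dist x y < e \<and> R x = R y \<longrightarrow> cell_of P x = cell_of P y)"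
proof -
  interpret prob_space M by fact
  have part: "partition_on (space M) P" "finite P" "P \<subseteq> sets M"
    using P by (auto simp: finite_measurable_partition_def)
  define N where "N = real (card P)"
  \<comment> \<open>Each of the \<open>N\<close> leftovers of mass below \<open>r\<^sup>2\<close>
    will contribute at most \<open>2 * r\<close>, and the value \<open>None\<close> at most
    \<open>N * r\<^sup>2 \<le> N * r\<close>; the total \<open>3 * N * r\<close> must not exceed
    \<open>d\<close>. The cap at 1 gives \<open>r\<^sup>2 \<le> r\<close>.\<close>
  define r where "r = min 1 (d / (3 * N + 1))"
  have N: "0 \<le> N" by (simp add: N_def)
  have r: "0 < r" "r \<le> 1" using d N by (auto simp: r_def)
  have "3 * N * r \<le> 3 * N * (d / (3 * N + 1))" using N by (intro mult_left_mono) (auto simp: r_def)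
  also have "\<dots> \<le> d" using N d by (simp add: divide_simps)
  finally have rd: "3 * N * r \<le> d" .
  have "\<forall>A\<in>P. \<exists>K\<subseteq>A. compact K \<and> K \<in> sets M \<and> prob (A - K) < r\<^sup>2"
    using part r by (intro ballI compact_inner_approx[OF assms(1-3)]) auto
  then obtain K where K: "\<And>A. A \<in> P \<Longrightarrow> K A \<subseteq> A" "\<And>A. A \<in> P \<Longrightarrow> compact (K A)"
    "\<And>A. A \<in> P \<Longrightarrow> K A \<in> sets M" "\<And>A. A \<in> P \<Longrightarrow> prob (A - K A) < r\<^sup>2" by metis
  have dis: "A \<in> P \<Longrightarrow> B \<in> P \<Longrightarrow> A \<noteq> B \<Longrightarrow> A \<inter> B = {}" for A B
    using part(1) by (auto simp: partition_on_def disjoint_def)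
  have "\<exists>e>0. \<forall>A\<in>P. \<forall>B\<in>P. \<forall>x\<in>K A. \<forall>y\<in>K B. dist x y < e \<longrightarrow> A = B"
    using part(2) K(1,2) dis by (intro finite_compact_family_separated) blast+
  then obtain e where e: "0 < e" "\<And>A B x y. A \<in> P \<Longrightarrow> B \<in> P \<Longrightarrow> x \<in> K A \<Longrightarrow> y \<in> K B \<Longrightarrow> dist x y < e \<Longrightarrow> A = B"
    by blast
  define R where "R x = (if x \<in> K (cell_of P x) then None else Some (cell_of P x))" for x
  have cell: "cell_of P x \<in> P" "x \<in> cell_of P x" if "x \<in> space M" for x
    using cell_of_mem[OF part(1) that] by auto
  have fSome: "R -` {Some A} \<inter> space M = A - K A" if "A \<in> P" for A
    using that K(1) cell cell_of_eq[OF part(1)] part(3)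
    by (fastforce simp: R_def split: if_splits dest: sets.sets_into_space)
  have fNone: "R -` {None} \<inter> space M = \<Union> (K ` P)"
  proof (intro equalityI subsetI)
    fix x assume "x \<in> R -` {None} \<inter> space M"
    with cell show "x \<in> \<Union> (K ` P)" by (auto simp: R_def split: if_splits)
  next
    fix x assume "x \<in> \<Union> (K ` P)"
    then obtain A where A: "A \<in> P" "x \<in> K A" by auto
    with K(1) have "x \<in> A" by auto
    moreover have "A \<subseteq> space M" using A part(3) by (auto dest: sets.sets_into_space)
    ultimately show "x \<in> R -` {None} \<inter> space M"
      using A cell_of_eq[OF part(1)] by (auto simp: R_def)
  qed
  have range: "R ` space M \<subseteq> insert None (Some ` P)" using cell by (auto simp: R_def)
  then have simple: "simple_function M R"
    unfolding simple_function_def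
  proof (intro conjI ballI)
    show "finite (R ` space M)" by (rule finite_subset[OF range]) (simp add: part(2))
    fix v assume "v \<in> R ` space M"
    with range consider "v = None" | A where "A \<in> P" "v = Some A" by auto
    then show "R -` {v} \<inter> space M \<in> sets M"
    proof cases
      case 1
      with K(3) part(2) show ?thesis by (auto simp: fNone intro!: sets.finite_UN)
    next
      case 2
      with K(3) part(3) show ?thesis by (auto simp: fSome)
    qed
  qed
  let ?eta = "\<lambda>v. - (prob_eq R v * ln (prob_eq R v))"
  have eta: "?eta v \<ge> 0" for v
  proof -
    have "prob_eq R v * ln (prob_eq R v) \<le> 0"
      by (cases "prob_eq R v = 0") (auto intro!: mult_nonneg_nonpos simp: less_le)
    then show ?thesis by simp
  qed
  have pSome: "prob_eq R (Some A) < r\<^sup>2" if "A \<in> P" for A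
    using K(4)[OF that] fSome[OF that] by (simp add: prob_eq_def)
  have "prob (space M) \<le> prob (\<Union> (K ` P) \<union> (\<Union>A\<in>P. A - K A))"
  proof (intro finite_measure_mono subsetI)
    fix x assume "x \<in> space M"
    with cell[of x] show "x \<in> \<Union> (K ` P) \<union> (\<Union>A\<in>P. A - K A)" by blast
  qed (use part K(3) in \<open>auto intro!: sets.finite_UN\<close>)
  also have "\<dots> \<le> prob (\<Union> (K ` P)) + prob (\<Union>A\<in>P. A - K A)"
    using part K(3) by (intro measure_Un_le) (auto intro!: sets.finite_UN)
  also have "prob (\<Union>A\<in>P. A - K A) \<le> (\<Sum>A\<in>P. prob (A - K A))"
    using part K(3) by (intro measure_UNION_le) auto
  also have "\<dots> \<le> (\<Sum>A\<in>P. r\<^sup>2)" using K(4) by (intro sum_mono) (auto intro: less_imp_le)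
  finally have pNone: "1 - N * r\<^sup>2 \<le> prob_eq R None" by (simp add: prob_space prob_eq_def fNone N_def)
  have "shannon R = (\<Sum>v\<in>R ` space M. ?eta v)" by (simp add: shannon_def sum_negf)
  also have "\<dots> \<le> (\<Sum>v\<in>insert None (Some ` P). ?eta v)"
    using range part(2) eta by (intro sum_mono2) auto
  also have "\<dots> = ?eta None + (\<Sum>A\<in>P. ?eta (Some A))"
    using part(2) by (subst sum.insert) (auto simp: sum.reindex)
  also have "\<dots> \<le> N * r\<^sup>2 + (\<Sum>A\<in>P. 2 * r)"
  proof (intro add_mono sum_mono)
    show "?eta None \<le> N * r\<^sup>2" using minus_xlnx_le[of "prob_eq R None"] pNone by simp
    fix A assume "A \<in> P"
    then have "sqrt (prob_eq R (Some A)) \<le> sqrt (r\<^sup>2)"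
      using pSome[of A] by (intro real_sqrt_le_mono) simp
    with r minus_xlnx_le_sqrt[of "prob_eq R (Some A)"] show "?eta (Some A) \<le> 2 * r" by simp
  qed
  also have "\<dots> \<le> N * r + N * (2 * r)"
    using mult_left_mono[OF mult_left_le[of r r] N] r by (simp add: N_def power2_eq_square mult.commute)
  also have "\<dots> \<le> d" using rd by simp
  finally have "shannon R \<le> d" .
  moreover have "cell_of P x = cell_of P y"
    if "x \<in> space M" "y \<in> space M" "dist x y < e" "R x = R y" for x y
    using that cell e(2)[of "cell_of P x" "cell_of P y" x y] by (auto simp: R_def split: if_splits)
  ultimately show ?thesis using e(1) simple by blast
qed

context mpt begin

text \<open>The cell at time \<open>k\<close> is read off from the window of \<open>c\<close> of
  length \<open>J\<close> that starts at \<open>k\<close> and from \<open>R\<close> at time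
  \<open>k\<close>. Completing the last windows costs a constant, and \<open>R\<close> costs at most
  its entropy per step.\<close>

lemma rate_cell_le:
  assumes P: "finite_measurable_partition M P" and c: "simple_function M c"
    and R: "simple_function M R" "shannon R \<le> d"
    and det: "\<And>x y. x \<in> space M \<Longrightarrow> y \<in> space M \<Longrightarrow> itinerary T c J x = itinerary T c J y \<Longrightarrow>
      R x = R y \<Longrightarrow> cell_of P x = cell_of P y"
  shows "rate (cell_of P) \<le> rate c + ereal d"
proof -
  have "rate (cell_of P) \<le> rate c + ereal (shannon R)"
  proof (rule rate_le_add)
    fix n
    have "shannon (itinerary T (cell_of P) n) \<le>
      shannon (\<lambda>x. (itinerary T c (n + J) x, itinerary T R n x))"
    proof (rule shannon_le_of_factor)
      fix x y assume x: "x \<in> space M" and y: "y \<in> space M"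
        and eq: "(itinerary T c (n + J) x, itinerary T R n x) = (itinerary T c (n + J) y, itinerary T R n y)"
      show "itinerary T (cell_of P) n x = itinerary T (cell_of P) n y"
        unfolding itinerary_eq_iff
      proof (intro allI impI)
        fix k assume k: "k < n"
        have "itinerary T c J ((T ^^ k) x) = itinerary T c J ((T ^^ k) y)"
          using eq k by (intro itinerary_shift_eq[of T c "n + J"]) auto
        moreover have "R ((T ^^ k) x) = R ((T ^^ k) y)" using eq k by (simp add: itinerary_eq_iff)
        ultimately show "cell_of P ((T ^^ k) x) = cell_of P ((T ^^ k) y)"
          using x y by (intro det) (auto intro: T_pow_space)
      qed
    qed (intro simple_function_Pair simple_function_itinerary c R)
    also have "\<dots> \<le> shannon (itinerary T c (n + J)) + shannon (itinerary T R n)"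
      by (intro shannon_Pair_le simple_function_itinerary c R)
    also have "shannon (itinerary T c (n + J)) \<le> shannon (itinerary T c n) + shannon (itinerary T c J)"
      by (rule shannon_itinerary_add[OF c])
    also have "shannon (itinerary T R n) \<le> real n * shannon R"
      by (rule shannon_itinerary_le[OF R(1)])
    finally show "shannon (itinerary T (cell_of P) n) \<le>
        shannon (itinerary T c n) + (shannon (itinerary T c J) + real n * shannon R)" by simp
  next
    have "(\<lambda>n. shannon (itinerary T c J) / real n + shannon R) \<longlonglongrightarrow> 0 + shannon R"
      by (intro tendsto_intros lim_const_over_n)
    then show "(\<lambda>n. (shannon (itinerary T c J) + real n * shannon R) / real n) \<longlonglongrightarrow> shannon R"
      by (rule Lim_transform_eventually[THEN tendsto_eq_rhs])
        (auto simp: eventually_sequentially add_divide_distrib intro!: exI[of _ 1])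
  qed
  also have "\<dots> \<le> rate c + ereal d" using R(2) by (intro add_left_mono) simp
  finally show ?thesis .
qed

end


text \<open>Stands in for the generator theorem: instead of one generating partition, each scale
  \<open>e\<close> may have its own coding, provided that all their rates are at most
  \<open>b\<close>.\<close>

theorem ks_entropy_le:
  fixes M :: "'a::{heine_borel, second_countable_topology} measure"
  assumes "mpt M T" "sets M = sets (restrict_space borel S)" "S \<in> sets borel"
    and fine: "\<And>e. 0 < e \<Longrightarrow> \<exists>(c :: 'a \<Rightarrow> 'c) J. simple_function M c \<and> mpt.rate M T c \<le> b \<and>
      (\<forall>x\<in>space M. \<forall>y\<in>space M. itinerary T c J x = itinerary T c J y \<longrightarrow> dist x y < e)"
  shows "ks_entropy T M \<le> b"
  unfolding ks_entropy_def
proof (intro SUP_least)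
  interpret mpt M T by fact
  fix P assume "P \<in> {P. finite_measurable_partition M P}"
  then have P: "finite_measurable_partition M P" by simp
  have "rate (cell_of P) \<le> b + ereal d" if d: "0 < d" for d
  proof -
    obtain e R where e: "0 < e" "simple_function M (R :: 'a \<Rightarrow> 'a set option)" "shannon R \<le> d"
      "\<And>x y. x \<in> space M \<Longrightarrow> y \<in> space M \<Longrightarrow> dist x y < e \<Longrightarrow> R x = R y \<Longrightarrow> cell_of P x = cell_of P y"
      using partition_approx[OF prob_space_axioms assms(2,3) P d] by blast
    obtain c :: "'a \<Rightarrow> 'c" and J where c: "simple_function M c" "rate c \<le> b"
      "\<And>x y. x \<in> space M \<Longrightarrow> y \<in> space M \<Longrightarrow> itinerary T c J x = itinerary T c J y \<Longrightarrow> dist x y < e"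
      using fine[OF e(1)] by blast
    have "rate (cell_of P) \<le> rate c + ereal d"
      using c(3) e(4) by (intro rate_cell_le[OF P c(1) e(2,3)]) blast
    also have "\<dots> \<le> b + ereal d" by (intro add_right_mono c)
    finally show ?thesis .
  qed
  then have "rate (cell_of P) \<le> b"
    by (rule ereal_le_epsilon2[rule_format])
  then show "ks_entropy_partition M T P \<le> b" by (simp add: ks_entropy_partition_eq_rate[OF P])
qed

section \<open>The map and the complexity of its itineraries\<close>

text \<open>In both coordinates \<open>6 * x - y\<close> is the interpolating piece: on
  \<open>y = 4 * x\<close> it equals \<open>2 * x\<close> and \<open>y / 2\<close>, on
  \<open>y = 2 * x\<close> it equals \<open>4 * (y - x)\<close> and \<open>2 * y\<close>. The strip
  between these lines therefore goes to the diagonal; the outer \<open>min\<close> and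
  \<open>max\<close> only clip to the square.\<close>

definition cone_map :: "real \<times> real \<Rightarrow> real \<times> real" where
  "cone_map = (\<lambda>(x, y). (min 1 (max 0 (min (max (2 * x) (6 * x - y)) (4 * (y - x)))),
                 min 1 (max (y / 2) (min (6 * x - y) (2 * y)))))"

definition low :: "real \<times> real \<Rightarrow> bool" where
  "low p \<longleftrightarrow> 4 * fst p \<le> snd p"

text \<open>The conjunct \<open>\<not> low p\<close> excludes just the origin, which counts as
  \<open>low\<close>. The last conjunct says that the new first coordinate is not clipped, so that
  the branch can be inverted.\<close>

definition high :: "real \<times> real \<Rightarrow> bool" where
  "high p \<longleftrightarrow> \<not> low p \<and> snd p \<le> 2 * fst p \<and> fst p \<le> snd p \<and> 4 * (snd p - fst p) \<le> 1"

definition exceptional :: "real \<times> real \<Rightarrow> bool" where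
  "exceptional p \<longleftrightarrow> \<not> low p \<and> \<not> high p"

lemma mem_unit_square: "p \<in> unit_square \<longleftrightarrow> 0 \<le> fst p \<and> fst p \<le> 1 \<and> 0 \<le> snd p \<and> snd p \<le> 1"
  by (cases p) (auto simp: unit_square_def)

lemma cone_map_mem: "p \<in> unit_square \<Longrightarrow> cone_map p \<in> unit_square"
  by (cases p) (auto simp: cone_map_def mem_unit_square)

lemma cone_map_pow_mem: "p \<in> unit_square \<Longrightarrow> (cone_map ^^ k) p \<in> unit_square"
  by (induction k) (auto intro: cone_map_mem)

lemma cone_map_low:
  assumes "p \<in> unit_square" "low p" shows "cone_map p = (2 * fst p, snd p / 2)"
  using assms by (cases p) (auto simp: cone_map_def mem_unit_square low_def)

lemma cone_map_high:
  assumes "p \<in> unit_square" "snd p \<le> 2 * fst p" "fst p \<le> snd p" "4 * (snd p - fst p) \<le> 1"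
  shows "cone_map p = (4 * (snd p - fst p), min 1 (2 * snd p))"
  using assms by (cases p) (auto simp: cone_map_def mem_unit_square)

text \<open>The trap behind the exceptional points: the left side of the square and the diagonal.
  The diagonal is sent to the left side, and the left side to itself.\<close>

definition terminal :: "(real \<times> real) set" where
  "terminal = {p. fst p = 0 \<or> fst p = snd p}"

lemma cone_map_middle:
  assumes "p \<in> unit_square" "\<not> low p" "2 * fst p < snd p"
  shows "cone_map p = (min 1 (6 * fst p - snd p), min 1 (6 * fst p - snd p))"
  using assms by (cases p) (auto simp: cone_map_def mem_unit_square low_def)

lemma cone_map_below_diagonal:
  assumes "p \<in> unit_square" "snd p < fst p" shows "cone_map p = (0, min 1 (2 * snd p))"
  using assms by (cases p) (auto simp: cone_map_def mem_unit_square)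

lemma cone_map_clipped:
  assumes "p \<in> unit_square" "snd p \<le> 2 * fst p" "fst p \<le> snd p" "1 < 4 * (snd p - fst p)"
  shows "cone_map p = (1, 1)"
  using assms by (cases p) (auto simp: cone_map_def mem_unit_square)

text \<open>The three kinds of exceptional points are sent to the diagonal, to the left side, and to
  the corner \<open>(1, 1)\<close>.\<close>

lemma cone_map_exceptional:
  assumes p: "p \<in> unit_square" "exceptional p" shows "cone_map p \<in> terminal"
proof -
  consider "2 * fst p < snd p" | "snd p < fst p" |
    "snd p \<le> 2 * fst p" "fst p \<le> snd p" "1 < 4 * (snd p - fst p)"
    using p by (fastforce simp: exceptional_def high_def)
  then show ?thesis
    using p cone_map_middle[OF p(1)] cone_map_below_diagonal[OF p(1)] cone_map_clipped[OF p(1)]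
    by cases (auto simp: terminal_def exceptional_def)
qed

lemma cone_map_terminal:
  assumes "p \<in> unit_square" "p \<in> terminal" shows "cone_map p \<in> terminal"
  using assms cone_map_low[of p] cone_map_high[of p]
  by (auto simp: terminal_def mem_unit_square low_def)

lemma not_exceptional_terminal:
  assumes "p \<in> unit_square" "p \<in> terminal" shows "\<not> exceptional p"
  using assms by (cases p) (auto simp: mem_unit_square terminal_def exceptional_def low_def high_def)

text \<open>From the step after an exceptional visit on, the orbit stays in \<open>terminal\<close>,
  which has no exceptional points. Hence the exceptional times along an orbit can be described by a
  single number.\<close>

lemma not_exceptional_later:
  assumes p: "p \<in> unit_square" and "exceptional ((cone_map ^^ k) p)" "k < j"
  shows "\<not> exceptional ((cone_map ^^ j) p)"
proof -
  have "(cone_map ^^ (Suc k + i)) p \<in> terminal" for i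
  proof (induction i)
    case 0
    then show ?case using assms by (auto intro!: cone_map_exceptional cone_map_pow_mem)
  next
    case (Suc i)
    with p show ?case using cone_map_terminal[OF cone_map_pow_mem[OF p, of "Suc k + i"]] by simp
  qed
  from this[of "j - Suc k"] assms(3) have "(cone_map ^^ j) p \<in> terminal" by simp
  with not_exceptional_terminal[OF cone_map_pow_mem[OF p]] show ?thesis by blast
qed

text \<open>The first coordinate is recorded at exceptional points only: on the two branches it can
  be recovered from the future, and recording it there would spoil the polynomial count.\<close>

definition code :: "nat \<Rightarrow> real \<times> real \<Rightarrow> (bool \<times> bool) \<times> nat \<times> nat" where
  "code m p = ((low p, high p), nat \<lfloor>real m * snd p\<rfloor>,
     if exceptional p then nat \<lfloor>real m * fst p\<rfloor> else 0)"

section \<open>Polynomially many code words over one \<open>low\<close> word\<close>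

lemma snd_cone_map_mono:
  assumes "p \<in> unit_square" "q \<in> unit_square" "\<not> exceptional p" "\<not> exceptional q" "low p = low q"
    and "snd p \<le> snd q"
  shows "snd (cone_map p) \<le> snd (cone_map q)"
  using assms cone_map_low[of p] cone_map_low[of q] cone_map_high[of p] cone_map_high[of q]
  by (cases "low p") (auto simp: exceptional_def high_def)

lemma snd_pow_mono:
  assumes "p \<in> unit_square" "q \<in> unit_square" "snd p \<le> snd q"
    and "\<And>j. j < k \<Longrightarrow> \<not> exceptional ((cone_map ^^ j) p) \<and> \<not> exceptional ((cone_map ^^ j) q) \<and>
      low ((cone_map ^^ j) p) = low ((cone_map ^^ j) q)"
  shows "snd ((cone_map ^^ k) p) \<le> snd ((cone_map ^^ k) q)"
  using assms(4)
proof (induction k)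
  case (Suc k)
  then show ?case using assms(1,2) by (auto intro!: snd_cone_map_mono cone_map_pow_mem)
qed (use assms in auto)

text \<open>Along a common itinerary the heights of two orbits are ordered in the same way at all times, so
  the sum of the rounded heights determines each of them.\<close>

lemma rounded_heights_eq:
  assumes "p \<in> unit_square" "q \<in> unit_square"
    and ne: "\<And>j. Suc j < N \<Longrightarrow> \<not> exceptional ((cone_map ^^ j) p) \<and> \<not> exceptional ((cone_map ^^ j) q) \<and>
      low ((cone_map ^^ j) p) = low ((cone_map ^^ j) q)"
    and eq: "(\<Sum>j<N. nat \<lfloor>real m * snd ((cone_map ^^ j) p)\<rfloor>) = (\<Sum>j<N. nat \<lfloor>real m * snd ((cone_map ^^ j) q)\<rfloor>)"
    and "j < N"
  shows "nat \<lfloor>real m * snd ((cone_map ^^ j) p)\<rfloor> = nat \<lfloor>real m * snd ((cone_map ^^ j) q)\<rfloor>"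
proof (cases "snd p \<le> snd q")
  case True
  then have "nat \<lfloor>real m * snd ((cone_map ^^ i) p)\<rfloor> \<le> nat \<lfloor>real m * snd ((cone_map ^^ i) q)\<rfloor>" if "i < N" for i
    using assms that by (intro nat_mono floor_mono mult_left_mono snd_pow_mono) auto
  with \<open>j < N\<close> show ?thesis
    by (intro sum_mono_inv[OF eq]) auto
next
  case False
  then have "nat \<lfloor>real m * snd ((cone_map ^^ i) q)\<rfloor> \<le> nat \<lfloor>real m * snd ((cone_map ^^ i) p)\<rfloor>" if "i < N" for i
    using assms that by (intro nat_mono floor_mono mult_left_mono snd_pow_mono) auto
  with \<open>j < N\<close> show ?thesis
    by (intro sum_mono_inv[OF eq[symmetric], symmetric]) auto
qed

text \<open>All that a \<open>low\<close> word leaves open about the code word: the exceptional time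
  (\<open>n\<close> if there is none earlier), the sums of rounded heights up to and after that
  time, and the rounded first coordinate at that time.\<close>

definition label :: "nat \<Rightarrow> nat \<Rightarrow> real \<times> real \<Rightarrow> nat \<times> nat \<times> nat \<times> nat" where
  "label m n p = (let k = (LEAST k. k = n \<or> exceptional ((cone_map ^^ k) p)) in
     (k, \<Sum>j<min n (Suc k). nat \<lfloor>real m * snd ((cone_map ^^ j) p)\<rfloor>,
      \<Sum>j<n - Suc k. nat \<lfloor>real m * snd ((cone_map ^^ j) ((cone_map ^^ Suc k) p))\<rfloor>,
      nat \<lfloor>real m * fst ((cone_map ^^ k) p)\<rfloor>))"

lemma nat_floor_le: "x \<le> 1 \<Longrightarrow> nat \<lfloor>real m * x\<rfloor> \<le> m"
proof -
  assume "x \<le> 1"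
  then have "real m * x \<le> real m" by (simp add: mult_left_le)
  then have "\<lfloor>real m * x\<rfloor> \<le> int m" by (metis floor_mono floor_of_nat)
  then show ?thesis by simp
qed

lemma sum_nat_floor_le:
  assumes "p \<in> unit_square" "N \<le> n"
  shows "(\<Sum>j<N. nat \<lfloor>real m * snd ((cone_map ^^ j) p)\<rfloor>) \<le> n * m"
proof -
  have "(\<Sum>j<N. nat \<lfloor>real m * snd ((cone_map ^^ j) p)\<rfloor>) \<le> N * m"
    using sum_bounded_above[of "{..<N}" "\<lambda>j. nat \<lfloor>real m * snd ((cone_map ^^ j) p)\<rfloor>" m]
      cone_map_pow_mem[OF assms(1)] by (auto simp: mem_unit_square intro!: nat_floor_le)
  also have "\<dots> \<le> n * m" using assms(2) by simp
  finally show ?thesis .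
qed

lemma label_mem:
  assumes p: "p \<in> unit_square"
  shows "label m n p \<in> {..n} \<times> {..n * m} \<times> {..n * m} \<times> {..m}"
proof -
  define k where "k = (LEAST k. k = n \<or> exceptional ((cone_map ^^ k) p))"
  have "k \<le> n" unfolding k_def by (rule Least_le) simp
  moreover have "(\<Sum>j<n - Suc k. nat \<lfloor>real m * snd ((cone_map ^^ j) ((cone_map ^^ Suc k) p))\<rfloor>) \<le> n * m"
    by (rule sum_nat_floor_le[OF cone_map_pow_mem[OF p]]) simp
  moreover have "(\<Sum>j<min n (Suc k). nat \<lfloor>real m * snd ((cone_map ^^ j) p)\<rfloor>) \<le> n * m"
    by (rule sum_nat_floor_le[OF p]) simp
  moreover have "nat \<lfloor>real m * fst ((cone_map ^^ k) p)\<rfloor> \<le> m"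
    using cone_map_pow_mem[OF p, of k] by (intro nat_floor_le) (simp add: mem_unit_square)
  ultimately show ?thesis by (simp add: label_def k_def[symmetric] Let_def)
qed

lemma itinerary_code_eq:
  assumes p: "p \<in> unit_square" and q: "q \<in> unit_square"
    and Q: "itinerary cone_map low n p = itinerary cone_map low n q"
    and L: "label m n p = label m n q"
  shows "itinerary cone_map (code m) n p = itinerary cone_map (code m) n q"
proof -
  define k where "k p = (LEAST k. k = n \<or> exceptional ((cone_map ^^ k) p))" for p
  have k: "k p = n \<or> exceptional ((cone_map ^^ k p) p)" for p
    unfolding k_def by (rule LeastI[of _ n]) simp
  have k_less: "\<not> exceptional ((cone_map ^^ j) p)" if "j < k p" for j p
    using not_less_Least[OF that[unfolded k_def]] by simp
  have keq: "k q = k p" using L by (simp add: label_def k_def Let_def)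
  have low: "low ((cone_map ^^ j) p) = low ((cone_map ^^ j) q)" if "j < n" for j
    using Q that by (simp add: itinerary_eq_iff)
  have ex: "exceptional ((cone_map ^^ j) r) \<longleftrightarrow> j = k r" if "r \<in> unit_square" "j < n" for j r
    using k[of r] k_less[of j r] not_exceptional_later[OF that(1), of "k r" j] that
    by (cases j "k r" rule: linorder_cases) auto
  have before: "nat \<lfloor>real m * snd ((cone_map ^^ j) p)\<rfloor> = nat \<lfloor>real m * snd ((cone_map ^^ j) q)\<rfloor>"
    if "j < n" "j \<le> k p" for j
  \<comment> \<open>The block includes the exceptional time itself: its height is reached through
    regular steps only, which is why the rule restricts \<open>j\<close> by
    \<open>Suc j < N\<close>.\<close>
  proof (rule rounded_heights_eq[OF p q, where N = "min n (Suc (k p))"])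
    show "(\<Sum>j<min n (Suc (k p)). nat \<lfloor>real m * snd ((cone_map ^^ j) p)\<rfloor>) =
      (\<Sum>j<min n (Suc (k p)). nat \<lfloor>real m * snd ((cone_map ^^ j) q)\<rfloor>)"
      using L keq by (simp add: label_def k_def[symmetric] Let_def)
  qed (use that low ex[OF p] ex[OF q] keq in auto)
  \<comment> \<open>The exceptional step may reverse the order of the two heights, so the comparison
    restarts after it with a sum of its own.\<close>
  have after: "nat \<lfloor>real m * snd ((cone_map ^^ j) p)\<rfloor> = nat \<lfloor>real m * snd ((cone_map ^^ j) q)\<rfloor>"
    if "j < n" "k p < j" for j
  proof -
    let ?p = "(cone_map ^^ Suc (k p)) p" and ?q = "(cone_map ^^ Suc (k p)) q"
    have pow: "(cone_map ^^ i) ((cone_map ^^ Suc (k p)) r) = (cone_map ^^ (i + Suc (k p))) r" for i r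
      by (simp only: funpow_add comp_apply)
    have "nat \<lfloor>real m * snd ((cone_map ^^ (j - Suc (k p))) ?p)\<rfloor> =
      nat \<lfloor>real m * snd ((cone_map ^^ (j - Suc (k p))) ?q)\<rfloor>"
    proof (rule rounded_heights_eq[where N = "n - Suc (k p)"])
      show "(\<Sum>j<n - Suc (k p). nat \<lfloor>real m * snd ((cone_map ^^ j) ?p)\<rfloor>) =
        (\<Sum>j<n - Suc (k p). nat \<lfloor>real m * snd ((cone_map ^^ j) ?q)\<rfloor>)"
        using L keq by (simp add: label_def k_def[symmetric] Let_def del: funpow.simps)
      fix i assume "Suc i < n - Suc (k p)"
      then show "\<not> exceptional ((cone_map ^^ i) ?p) \<and> \<not> exceptional ((cone_map ^^ i) ?q) \<and>
          low ((cone_map ^^ i) ?p) = low ((cone_map ^^ i) ?q)"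
        unfolding pow using ex[OF p, of "i + Suc (k p)"] ex[OF q, of "i + Suc (k p)"] keq
          low[of "i + Suc (k p)"] by simp
    qed (use that p q in \<open>auto intro: cone_map_pow_mem simp del: funpow.simps\<close>)
    then show ?thesis unfolding pow using that by simp
  qed
  show ?thesis unfolding itinerary_eq_iff
  proof (intro allI impI)
    fix j assume j: "j < n"
    have y: "nat \<lfloor>real m * snd ((cone_map ^^ j) p)\<rfloor> = nat \<lfloor>real m * snd ((cone_map ^^ j) q)\<rfloor>"
      using before[OF j] after[OF j] by linarith
    have e: "exceptional ((cone_map ^^ j) p) = exceptional ((cone_map ^^ j) q)"
      using ex[OF p j] ex[OF q j] keq by simp
    then have h: "high ((cone_map ^^ j) p) = high ((cone_map ^^ j) q)"
      using low[OF j] by (auto simp: exceptional_def high_def)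
    have "nat \<lfloor>real m * fst ((cone_map ^^ j) p)\<rfloor> = nat \<lfloor>real m * fst ((cone_map ^^ j) q)\<rfloor>"
      if "exceptional ((cone_map ^^ j) p)"
      using that L keq ex[OF p j] by (simp add: label_def k_def[symmetric] Let_def)
    with y e h low[OF j] show "code m ((cone_map ^^ j) p) = code m ((cone_map ^^ j) q)"
      by (simp add: code_def)
  qed
qed

definition label_count :: "nat \<Rightarrow> nat \<Rightarrow> nat" where
  "label_count m n = (n + 1) * (n * m + 1) * (n * m + 1) * (m + 1)"

lemma card_code_itineraries_le:
  assumes "S \<subseteq> unit_square" "\<And>p q. p \<in> S \<Longrightarrow> q \<in> S \<Longrightarrow>
    itinerary cone_map low n p = itinerary cone_map low n q"
  shows "card (itinerary cone_map (code m) n ` S) \<le> label_count m n"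
proof -
  let ?L = "{..n} \<times> {..n * m} \<times> {..n * m} \<times> {..m}"
  have sub: "label m n ` S \<subseteq> ?L" using label_mem assms(1) by blast
  have fin: "finite (label m n ` S)"
    using sub by (rule finite_subset) simp
  define f where "f l = itinerary cone_map (code m) n (SOME p. p \<in> S \<and> label m n p = l)" for l
  have "itinerary cone_map (code m) n p = f (label m n p)" if p: "p \<in> S" for p
  proof -
    define q where "q = (SOME q. q \<in> S \<and> label m n q = label m n p)"
    have q: "q \<in> S" "label m n q = label m n p"
      using someI[of "\<lambda>q. q \<in> S \<and> label m n q = label m n p" p] p by (simp_all add: q_def)
    have "itinerary cone_map (code m) n p = itinerary cone_map (code m) n q"
      using p q(1) assms(1) by (intro itinerary_code_eq[OF _ _ assms(2)[OF p q(1)] q(2)[symmetric]]) blast+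
    then show ?thesis by (simp only: f_def q_def)
  qed
  then have "itinerary cone_map (code m) n ` S = f ` label m n ` S"
    unfolding image_image by (intro image_cong) simp_all
  then have "card (itinerary cone_map (code m) n ` S) \<le> card (label m n ` S)"
    using fin by (simp add: card_image_le)
  also have "\<dots> \<le> card ?L" using sub by (intro card_mono) simp_all
  finally show ?thesis by (simp only: label_count_def card_cartesian_product card_atMost Suc_eq_plus1 mult.assoc)
qed

section \<open>Long code words determine points up to a small error\<close>

lemma nat_floor_eq_imp_close:
  assumes "nat \<lfloor>real m * a\<rfloor> = nat \<lfloor>real m * b\<rfloor>" "0 \<le> a" "0 \<le> b" "0 < m"
  shows "\<bar>a - b\<bar> \<le> 1 / real m"
proof -
  have "0 \<le> \<lfloor>real m * a\<rfloor>" "0 \<le> \<lfloor>real m * b\<rfloor>" using assms by auto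
  with assms(1) have "\<lfloor>real m * a\<rfloor> = \<lfloor>real m * b\<rfloor>" by linarith
  then have "\<bar>real m * a - real m * b\<bar> \<le> 1" by linarith
  then have "real m * \<bar>a - b\<bar> \<le> 1" by (simp add: abs_mult[of "real m", simplified, symmetric] right_diff_distrib)
  with assms(4) show ?thesis by (simp add: field_simps)
qed

text \<open>Backwards the branches read \<open>x = x' / 2\<close> and \<open>x = y - x' / 4\<close>.
  With \<open>a = 1 / real m\<close> for the error of the height, an error \<open>2 * a + r\<close>
  of \<open>x'\<close> becomes at most \<open>a + r / 2\<close> or
  \<open>a + (2 * a + r) / 4\<close>, both within \<open>2 * a + r / 2\<close>. At an exceptional
  point the recorded value bounds the error by \<open>a\<close>.\<close>

lemma fst_close:
  assumes "0 < m" "p \<in> unit_square" "q \<in> unit_square"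
    and "itinerary cone_map (code m) J p = itinerary cone_map (code m) J q"
  shows "\<bar>fst p - fst q\<bar> \<le> 2 / real m + (1 / 2) ^ J"
  using assms(2-)
proof (induction J arbitrary: p q)
  case 0
  have "\<bar>fst p - fst q\<bar> \<le> 0 + 1" using 0 by (auto simp: mem_unit_square)
  also have "\<dots> \<le> 2 / real m + (1 / 2) ^ 0" by simp
  finally show ?case .
next
  case (Suc J)
  have code: "code m p = code m q" using Suc.prems(3) by (auto simp: itinerary_eq_iff)
  have "itinerary cone_map (code m) J (cone_map p) = itinerary cone_map (code m) J (cone_map q)"
    using itinerary_shift_eq[OF Suc.prems(3), of 1 J] by simp
  then have "\<bar>fst (cone_map p) - fst (cone_map q)\<bar> \<le> 2 / real m + (1 / 2) ^ J"
    using Suc.prems by (intro Suc.IH cone_map_mem)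
  moreover define a r where "a = 1 / real m" and "r = (1 / 2 :: real) ^ J"
  ultimately have IH: "\<bar>fst (cone_map p) - fst (cone_map q)\<bar> \<le> 2 * a + r" by simp
  have goal: "2 / real m + (1 / 2) ^ Suc J = 2 * a + r / 2" by (simp add: a_def r_def)
  have nonneg: "0 \<le> a" "0 \<le> r" by (simp_all add: a_def r_def)
  have y: "\<bar>snd p - snd q\<bar> \<le> a"
    using code Suc.prems assms(1) unfolding a_def
    by (intro nat_floor_eq_imp_close) (auto simp: code_def mem_unit_square)
  consider "low p" "low q" | "high p" "high q" | "exceptional p" "exceptional q"
    using code by (auto simp: code_def exceptional_def)
  then show ?case unfolding goal
  proof cases
    case 1
    then have "fst (cone_map p) = 2 * fst p" "fst (cone_map q) = 2 * fst q"
      using Suc.prems by (auto simp: cone_map_low)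
    with IH nonneg show "\<bar>fst p - fst q\<bar> \<le> 2 * a + r / 2" by (simp add: abs_le_iff)
  next
    case 2
    then have "fst (cone_map p) = 4 * (snd p - fst p)" "fst (cone_map q) = 4 * (snd q - fst q)"
      using Suc.prems by (auto simp: high_def cone_map_high)
    with IH nonneg y show "\<bar>fst p - fst q\<bar> \<le> 2 * a + r / 2" by (simp add: abs_le_iff)
  next
    case 3
    then have "\<bar>fst p - fst q\<bar> \<le> a"
      using code Suc.prems assms(1) unfolding a_def
      by (intro nat_floor_eq_imp_close) (auto simp: code_def mem_unit_square)
    with nonneg show "\<bar>fst p - fst q\<bar> \<le> 2 * a + r / 2" by simp
  qed
qed

lemma code_itineraries_fine:
  assumes "0 < e"
  shows "\<exists>m J. \<forall>p\<in>unit_square. \<forall>q\<in>unit_square.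
    itinerary cone_map (code m) J p = itinerary cone_map (code m) J q \<longrightarrow> dist p q < e"
proof -
  \<comment> \<open>The two coordinates together contribute three errors \<open>1 / real m\<close>,
    which must stay below \<open>e / 2\<close>.\<close>
  obtain m where m: "0 < m" "1 / real m < e / 6"
    using assms by (metis divide_pos_pos ex_inverse_of_nat_less inverse_eq_divide zero_less_numeral)
  obtain J where J: "(1 / 2 :: real) ^ J < e / 2"
    using assms by (metis half_gt_zero one_less_numeral_iff real_arch_pow_inv semiring_norm(76) divide_less_eq_1_pos zero_less_numeral)
  \<comment> \<open>Length \<open>Suc J\<close> guarantees one letter, from which the height at time
    0 is read.\<close>
  have "dist p q < e" if pq: "p \<in> unit_square" "q \<in> unit_square"
    "itinerary cone_map (code m) (Suc J) p = itinerary cone_map (code m) (Suc J) q" for p q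
  proof -
    have "code m p = code m q" using pq(3) by (auto simp: itinerary_eq_iff)
    then have "\<bar>snd p - snd q\<bar> \<le> 1 / real m"
      using pq m(1) by (intro nat_floor_eq_imp_close) (auto simp: code_def mem_unit_square)
    moreover have "\<bar>fst p - fst q\<bar> \<le> 2 / real m + (1 / 2) ^ Suc J"
      by (rule fst_close[OF m(1) pq])
    moreover have "dist p q \<le> \<bar>fst p - fst q\<bar> + \<bar>snd p - snd q\<bar>"
      using sqrt_sum_squares_le_sum_abs by (simp add: dist_prod_def dist_real_def)
    moreover have "0 \<le> (1 / 2 :: real) ^ J" by simp
    ultimately show ?thesis using m J by simp
  qed
  then show ?thesis by blast
qed

lemma label_count_le: "label_count m (n + k) \<le> ((n + k + 1) * (m + 1)) ^ 4"
proof -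
  let ?N = "n + k" and ?a = "(n + k + 1) * (m + 1)"
  have "?N + 1 \<le> ?a" "?N * m + 1 \<le> ?a" "m + 1 \<le> ?a" by simp_all
  then have "label_count m ?N \<le> ?a * ?a * ?a * ?a"
    unfolding label_count_def by (intro mult_le_mono)
  then show ?thesis by (simp only: power4_eq_xxxx)
qed

lemma label_count_pos: "0 < label_count m n"
  by (simp add: label_count_def)

lemma ln_label_count_over_n: "(\<lambda>n. ln (real (label_count m (n + k))) / real n) \<longlonglongrightarrow> 0"
proof (rule tendsto_sandwich)
  define a where "a = real k + 1"
  have a: "0 < a" by (simp add: a_def)
  show "\<forall>\<^sub>F n in sequentially. 0 \<le> ln (real (label_count m (n + k))) / real n"
    using label_count_pos by (simp add: Suc_leI)
  have "ln (real (label_count m (n + k))) / real n \<le>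
    4 * (ln (real n + a) + ln (real (m + 1))) / real n" for n
  proof (rule divide_right_mono)
    have "ln (real (label_count m (n + k))) \<le> ln (real (((n + k + 1) * (m + 1)) ^ 4))"
      using label_count_le[of m n k] label_count_pos[of m "n + k"]
      by (intro ln_mono) (simp_all only: of_nat_le_iff of_nat_0_less_iff)
    also have "real (((n + k + 1) * (m + 1)) ^ 4) = ((real n + a) * real (m + 1)) ^ 4"
      unfolding of_nat_power of_nat_mult by (simp add: a_def add_ac)
    also have "ln (((real n + a) * real (m + 1)) ^ 4) = 4 * ln ((real n + a) * real (m + 1))"
      by (simp add: ln_realpow a_def add_ac del: mult_Suc mult_Suc_right)
    also have "\<dots> = 4 * (ln (real n + a) + ln (real (m + 1)))"
      using a by (subst ln_mult) auto
    finally show "ln (real (label_count m (n + k))) \<le> 4 * (ln (real n + a) + ln (real (m + 1)))" .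
  qed simp
  then show "\<forall>\<^sub>F n in sequentially. ln (real (label_count m (n + k))) / real n \<le>
    4 * (ln (real n + a) + ln (real (m + 1))) / real n"
    by (intro always_eventually allI)
  show "(\<lambda>n. 4 * (ln (real n + a) + ln (real (m + 1))) / real n) \<longlonglongrightarrow> 0"
    using a by real_asymp
qed simp

section \<open>Upper bounds for the entropies\<close>

lemma card_bool_lists: "card {w :: bool list. length w = n} = 2 ^ n"
  using card_lists_length_eq[of "UNIV :: bool set" n] by simp

lemma finite_bool_lists: "finite {w :: bool list. length w = n}"
  using finite_lists_length_eq[of "UNIV :: bool set" n] by simp

lemma card_low_itineraries_le: "card (itinerary T (c :: _ \<Rightarrow> bool) n ` S) \<le> 2 ^ n"
proof -
  have "card (itinerary T c n ` S) \<le> card {w :: bool list. length w = n}"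
    by (rule card_mono[OF finite_bool_lists]) auto
  then show ?thesis by (simp only: card_bool_lists)
qed

lemma finite_code_image: "finite (code m ` unit_square)"
proof (rule finite_subset)
  show "code m ` unit_square \<subseteq> UNIV \<times> {..m} \<times> {..m}"
    by (auto simp: code_def mem_unit_square intro!: nat_floor_le)
qed simp

lemma finite_code_itineraries: "finite (itinerary cone_map (code m) n ` unit_square)"
  using finite_code_image cone_map_mem by (intro finite_itineraries) auto

lemma card_all_code_itineraries_le:
  "card (itinerary cone_map (code m) n ` unit_square) \<le> 2 ^ n * label_count m n"
proof -
  let ?L = "itinerary cone_map low n ` unit_square"
  let ?F = "\<lambda>v. itinerary cone_map (code m) n ` {p \<in> unit_square. itinerary cone_map low n p = v}"
  have fin: "finite ?L" by (rule finite_subset[OF _ finite_bool_lists[of n]]) auto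
  have "itinerary cone_map (code m) n ` unit_square = (\<Union>v\<in>?L. ?F v)" by auto
  then have "card (itinerary cone_map (code m) n ` unit_square) \<le> (\<Sum>v\<in>?L. card (?F v))"
    using card_UN_le[OF fin, of ?F] by simp
  also have "\<dots> \<le> (\<Sum>v\<in>?L. label_count m n)"
    by (intro sum_mono card_code_itineraries_le) auto
  also have "\<dots> \<le> 2 ^ n * label_count m n"
    using card_low_itineraries_le[of cone_map low n unit_square] by simp
  finally show ?thesis .
qed

text \<open>One representative for each code word of length \<open>n + J\<close>: the extra
  \<open>J\<close> letters give every time \<open>k < n\<close> a complete window of length
  \<open>J\<close>.\<close>

lemma spanning_set_cone_map:
  assumes "\<forall>p\<in>unit_square. \<forall>q\<in>unit_square.
    itinerary cone_map (code m) J p = itinerary cone_map (code m) J q \<longrightarrow> dist p q < e"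
  shows "\<exists>E. spanning_set unit_square cone_map n e E \<and> E \<noteq> {} \<and>
    card E \<le> 2 ^ (n + J) * label_count m (n + J)"
proof -
  let ?I = "itinerary cone_map (code m) (n + J)"
  obtain E where E: "E \<subseteq> unit_square" "inj_on ?I E" "?I ` E = ?I ` unit_square"
    by (metis subset_image_inj subset_refl)
  have "finite (?I ` E)" unfolding E(3) by (rule finite_code_itineraries)
  then have fin: "finite E" using E(2) by (rule finite_imageD)
  have "spanning_set unit_square cone_map n e E"
    unfolding spanning_set_def
  proof (intro conjI ballI fin E(1))
    fix x assume x: "x \<in> unit_square"
    then have "?I x \<in> ?I ` E" unfolding E(3) by (rule imageI)
    then obtain y where y: "y \<in> E" "?I x = ?I y" by auto
    have "dist ((cone_map ^^ k) x) ((cone_map ^^ k) y) < e" if "k < n" for k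
      using assms cone_map_pow_mem[OF x, of k] cone_map_pow_mem[OF subsetD[OF E(1) y(1)], of k]
        itinerary_shift_eq[OF y(2), of k J] that by simp
    with y(1) show "\<exists>y\<in>E. \<forall>k<n. dist ((cone_map ^^ k) x) ((cone_map ^^ k) y) < e" by blast
  qed
  moreover have "E \<noteq> {}" using E(3) by (auto simp: unit_square_def)
  moreover have "card E \<le> 2 ^ (n + J) * label_count m (n + J)"
    using card_all_code_itineraries_le[of m "n + J"] card_image[OF E(2)] E(3) by simp
  ultimately show ?thesis by blast
qed

lemma topological_entropy_cone_map_le: "topological_entropy unit_square cone_map \<le> ereal (ln 2)"
  unfolding topological_entropy_def
proof (intro SUP_least)
  fix e :: real assume "e \<in> {0<..}"
  then obtain m J where mJ: "\<forall>p\<in>unit_square. \<forall>q\<in>unit_square.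
    itinerary cone_map (code m) J p = itinerary cone_map (code m) J q \<longrightarrow> dist p q < e"
    using code_itineraries_fine[of e] by auto
  define b where "b n = (real (n + J) * ln 2 + ln (real (label_count m (n + J)))) / real n" for n
  have le: "(INF E\<in>{E. spanning_set unit_square cone_map n e E}. ereal (ln (real (card E)) / real n)) \<le> ereal (b n)" for n
  proof -
    obtain E where E: "spanning_set unit_square cone_map n e E" "E \<noteq> {}"
      "card E \<le> 2 ^ (n + J) * label_count m (n + J)"
      using spanning_set_cone_map[OF mJ] by blast
    have "0 < card E" using E(1,2) by (simp add: spanning_set_def card_gt_0_iff)
    then have "ln (real (card E)) \<le> ln (real (2 ^ (n + J) * label_count m (n + J)))"
      using E(3) by (intro ln_mono) (simp_all only: of_nat_le_iff of_nat_0_less_iff)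
    also have "real (2 ^ (n + J) * label_count m (n + J)) = 2 ^ (n + J) * real (label_count m (n + J))"
      by simp
    also have "ln \<dots> = real (n + J) * ln 2 + ln (real (label_count m (n + J)))"
      using label_count_pos[of m "n + J"] by (subst ln_mult) (simp_all add: ln_realpow)
    finally have "ln (real (card E)) / real n \<le> b n" by (simp add: b_def divide_right_mono)
    then show ?thesis using E(1) by (intro INF_lower2[of E]) auto
  qed
  have "b \<longlonglongrightarrow> ln 2 + 0"
  proof -
    have "(\<lambda>n. real (n + J) * ln 2 / real n + ln (real (label_count m (n + J))) / real n) \<longlonglongrightarrow> ln 2 + 0"
      by (intro tendsto_add ln_label_count_over_n) real_asymp
    then show ?thesis by (simp add: b_def[abs_def] add_divide_distrib)
  qed
  then have "limsup (\<lambda>n. ereal (b n)) = ereal (ln 2)" by (intro lim_imp_Limsup) auto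
  moreover have "limsup (\<lambda>n. INF E\<in>{E. spanning_set unit_square cone_map n e E}. ereal (ln (real (card E)) / real n))
    \<le> limsup (\<lambda>n. ereal (b n))"
    by (intro Limsup_mono always_eventually allI le)
  ultimately show "limsup (\<lambda>n. INF E\<in>{E. spanning_set unit_square cone_map n e E}. ereal (ln (real (card E)) / real n))
    \<le> ereal (ln 2)" by simp
qed

lemma closed_unit_square: "closed unit_square"
  unfolding unit_square_def by (intro closed_Times closed_atLeastAtMost)

lemma space_invariant_prob_measures:
  "\<mu> \<in> invariant_prob_measures unit_square T \<Longrightarrow> space \<mu> = unit_square"
  using sets_eq_imp_space_eq[of \<mu> "restrict_space borel unit_square"]
  by (auto simp: invariant_prob_measures_def space_restrict_space)

lemma mpt_invariant_prob_measures:
  "\<mu> \<in> invariant_prob_measures K T \<Longrightarrow> mpt \<mu> T"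
  by (auto simp: invariant_prob_measures_def mpt_def mpt_axioms_def)

lemma borel_measurable_cone_map [measurable]: "cone_map \<in> borel_measurable borel"
  unfolding cone_map_def borel_prod[symmetric] by measurable

lemma pred_low [measurable]: "Measurable.pred borel low"
  unfolding low_def[abs_def] borel_prod[symmetric] by measurable

lemma pred_high [measurable]: "Measurable.pred borel high"
  unfolding high_def[abs_def] borel_prod[symmetric] low_def by measurable

lemma pred_exceptional [measurable]: "Measurable.pred borel exceptional"
  unfolding exceptional_def[abs_def] by measurable

lemma simple_functionI_borel:
  fixes f :: "'a::topological_space \<Rightarrow> 'b"
  assumes "sets \<mu> = sets (restrict_space borel K)" "f \<in> measurable borel (count_space UNIV)" "finite (f ` K)"
  shows "simple_function \<mu> f"
proof -
  have "space \<mu> = K"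
    using sets_eq_imp_space_eq[OF assms(1)] by (simp add: space_restrict_space)
  moreover have "f \<in> measurable \<mu> (count_space UNIV)"
    using measurable_restrict_space1[OF assms(2), of K] by (simp only: measurable_cong_sets[OF assms(1) refl])
  ultimately show ?thesis using assms(3) by (simp add: simple_function_eq_measurable)
qed

lemma simple_function_low:
  assumes "\<mu> \<in> invariant_prob_measures unit_square T" shows "simple_function \<mu> low"
  using assms by (intro simple_functionI_borel[of _ unit_square]) (auto simp: invariant_prob_measures_def)

lemma simple_function_code:
  assumes "\<mu> \<in> invariant_prob_measures unit_square T" shows "simple_function \<mu> (code m)"
proof -
  have s: "sets \<mu> = sets (restrict_space borel unit_square)"
    using assms by (simp add: invariant_prob_measures_def)
  have fin: "finite (f ` unit_square)" if "f ` unit_square \<subseteq> {..m}" for f :: "real \<times> real \<Rightarrow> nat"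
    using that by (rule finite_subset) simp
  have 1: "simple_function \<mu> high"
    by (intro simple_functionI_borel[OF s]) auto
  have 2: "simple_function \<mu> (\<lambda>p. nat \<lfloor>real m * snd p\<rfloor>)"
    by (intro simple_functionI_borel[OF s] fin) (auto simp: mem_unit_square borel_prod[symmetric] intro!: nat_floor_le)
  have 3: "simple_function \<mu> (\<lambda>p. if exceptional p then nat \<lfloor>real m * fst p\<rfloor> else 0)"
  proof (intro simple_functionI_borel[OF s] fin)
    show "(\<lambda>p. if exceptional p then nat \<lfloor>real m * fst p\<rfloor> else 0) \<in> borel \<rightarrow>\<^sub>M count_space UNIV"
    proof -
      have "(\<lambda>p :: real \<times> real. nat \<lfloor>real m * fst p\<rfloor>) \<in> borel \<rightarrow>\<^sub>M count_space UNIV"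
        by (auto simp: borel_prod[symmetric])
      then show ?thesis
        by (intro measurable_If measurable_const predE[OF pred_exceptional]) simp_all
    qed
  qed (auto simp: mem_unit_square intro!: nat_floor_le)
  show ?thesis unfolding code_def[abs_def]
    by (intro simple_function_Pair simple_function_low[OF assms] 1 2 3)
qed

text \<open>Over each \<open>low\<close> word there are at most \<open>label_count m n\<close> code
  words; this is polynomial in \<open>n\<close>, so its logarithm disappears in the rate.\<close>

lemma rate_code_le:
  assumes \<mu>: "\<mu> \<in> invariant_prob_measures unit_square cone_map"
  shows "mpt.rate \<mu> cone_map (code m) \<le> mpt.rate \<mu> cone_map low"
proof -
  interpret mpt \<mu> cone_map by (rule mpt_invariant_prob_measures[OF \<mu>])
  have "rate (code m) \<le> rate low + ereal 0"
  proof (rule rate_le_add)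
    show "shannon (itinerary cone_map (code m) n) \<le>
      shannon (itinerary cone_map low n) + ln (real (label_count m n))" for n
    proof (intro shannon_le_ln_card_fibres simple_function_itinerary simple_function_code[OF \<mu>] simple_function_low[OF \<mu>])
      fix v
      show "real (card (itinerary cone_map (code m) n ` (itinerary cone_map low n -` {v} \<inter> space \<mu>))) \<le> real (label_count m n)"
        unfolding of_nat_le_iff space_invariant_prob_measures[OF \<mu>]
        by (rule card_code_itineraries_le) auto
    qed
    show "(\<lambda>n. ln (real (label_count m n)) / real n) \<longlonglongrightarrow> 0"
      using ln_label_count_over_n[of m 0] by simp
  qed
  then show ?thesis by simp
qed

text \<open>The codes resolve points at every scale and none of them has a larger rate than
  \<open>low\<close>. So \<open>low\<close> carries all the entropy although it does not separate
  points.\<close>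

lemma ks_entropy_le_rate_low:
  assumes \<mu>: "\<mu> \<in> invariant_prob_measures unit_square cone_map"
  shows "ks_entropy cone_map \<mu> \<le> mpt.rate \<mu> cone_map low"
proof (rule ks_entropy_le[OF mpt_invariant_prob_measures[OF \<mu>], of unit_square])
  show "sets \<mu> = sets (restrict_space borel unit_square)"
    using \<mu> by (simp add: invariant_prob_measures_def)
  show "unit_square \<in> sets borel" using closed_unit_square by simp
  fix e :: real assume "0 < e"
  then obtain m J where "\<forall>p\<in>unit_square. \<forall>q\<in>unit_square.
    itinerary cone_map (code m) J p = itinerary cone_map (code m) J q \<longrightarrow> dist p q < e"
    using code_itineraries_fine by blast
  then show "\<exists>(c :: real \<times> real \<Rightarrow> (bool \<times> bool) \<times> nat \<times> nat) J. simple_function \<mu> c \<and> mpt.rate \<mu> cone_map c \<le> mpt.rate \<mu> cone_map low \<and>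
    (\<forall>x\<in>space \<mu>. \<forall>y\<in>space \<mu>. itinerary cone_map c J x = itinerary cone_map c J y \<longrightarrow> dist x y < e)"
    unfolding space_invariant_prob_measures[OF \<mu>]
    by (intro exI[of _ "code m"] exI[of _ J] conjI simple_function_code[OF \<mu>] rate_code_le[OF \<mu>])
qed

lemma ks_entropy_cone_map_le:
  assumes \<mu>: "\<mu> \<in> invariant_prob_measures unit_square cone_map"
  shows "ks_entropy cone_map \<mu> \<le> ereal (ln 2)"
proof -
  interpret mpt \<mu> cone_map by (rule mpt_invariant_prob_measures[OF \<mu>])
  have "ks_entropy cone_map \<mu> \<le> rate low" by (rule ks_entropy_le_rate_low[OF \<mu>])
  also have "\<dots> \<le> ereal (shannon (itinerary cone_map low 1) / real 1)"
    by (rule rate_le_shannon[OF simple_function_low[OF \<mu>]]) simp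
  also have "shannon (itinerary cone_map low 1) \<le> ln 2"
    using card_low_itineraries_le[of cone_map low 1 "space \<mu>"]
    by (intro shannon_le_ln_card simple_function_itinerary simple_function_low[OF \<mu>]) simp
  finally show ?thesis by simp
qed

section \<open>No measure of maximal entropy\<close>

text \<open>The level \<open>j\<close> stands for the height \<open>(1 / 2) ^ j\<close>. Truncated
  subtraction at \<open>j = 0\<close> is the reflection that the cut-off of heights at 1
  produces.\<close>

definition level_step :: "bool \<Rightarrow> nat \<Rightarrow> nat" where
  "level_step b j = (if b then Suc j else j - 1)"

text \<open>Off \<open>low\<close> the height at most doubles, at exceptional points too, so the
  walk bounds heights everywhere in the square and not just on the two branches.\<close>

lemma snd_cone_map_le:
  assumes p: "p \<in> unit_square" and le: "snd p \<le> (1 / 2) ^ j"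
  shows "snd (cone_map p) \<le> (1 / 2) ^ level_step (low p) j"
proof (cases "low p")
  case True
  with le show ?thesis by (simp add: cone_map_low[OF p] level_step_def)
next
  case False
  have "snd (cone_map p) \<le> min 1 (2 * snd p)"
    using p by (cases p) (auto simp: cone_map_def mem_unit_square)
  also have "\<dots> \<le> (1 / 2) ^ (j - 1)" using le by (cases j) auto
  finally show ?thesis using False by (simp add: level_step_def)
qed

lemma snd_cone_map_pow_le:
  assumes p: "p \<in> unit_square"
  shows "snd ((cone_map ^^ n) p) \<le> (1 / 2) ^ fold level_step (itinerary cone_map low n p) 0"
proof (induction n)
  case 0
  then show ?case using p by (simp add: mem_unit_square)
next
  case (Suc n)
  then show ?case using snd_cone_map_le[OF cone_map_pow_mem[OF p] Suc] by (simp add: itinerary_Suc)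
qed

text \<open>The walk that rests at 0 on a downward step is the simple walk on the integers folded
  about \<open>-1/2\<close>. Level \<open>j\<close> then stands for the end points \<open>j\<close>
  and \<open>- j - 1\<close>, of which exactly one has the parity of \<open>n\<close>; this explains
  the rounding. The induction itself is Pascal's rule.\<close>

lemma card_words_level:
  "card {w. length w = n \<and> fold level_step w 0 = j} = n choose ((n + j + 1) div 2)"
proof (induction n arbitrary: j)
  case 0
  show ?case
  proof (cases "j = 0")
    case True
    then have "{w. length w = 0 \<and> fold level_step w 0 = j} = {[]}" by auto
    then show ?thesis using True by simp
  next
    case False
    then obtain i where j: "j = Suc i" using not0_implies_Suc by blast
    have "{w. length w = 0 \<and> fold level_step w 0 = j} = {}" by (auto simp: j)
    then show ?thesis by (simp only: card.empty) (simp add: j)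
  qed
next
  case (Suc n)
  let ?C = "\<lambda>n P. {w. length w = n \<and> P (fold level_step w 0)}"
  have fin: "finite (?C n P)" for P
    by (rule finite_subset[OF _ finite_bool_lists[of n]]) auto
  have split: "?C (Suc n) (\<lambda>i. i = j) =
    (\<lambda>w. w @ [True]) ` ?C n (\<lambda>i. Suc i = j) \<union> (\<lambda>w. w @ [False]) ` ?C n (\<lambda>i. i - 1 = j)"
    (is "?L = ?R")
  proof (intro equalityI subsetI)
    fix w assume w: "w \<in> ?L"
    then obtain v b where "w = v @ [b]" by (cases w rule: rev_cases) auto
    with w show "w \<in> ?R" by (cases b) (auto simp: level_step_def)
  qed (auto simp: level_step_def)
  have "card ?L = card (?C n (\<lambda>i. Suc i = j)) + card (?C n (\<lambda>i. i - 1 = j))"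
    unfolding split using fin[of "\<lambda>i. Suc i = j"] fin[of "\<lambda>i. i - 1 = j"]
    by (subst card_Un_disjoint) (auto simp: card_image inj_on_def)
  also have "\<dots> = Suc n choose ((Suc n + j + 1) div 2)"
  proof (cases j)
    case 0
    have "?C n (\<lambda>i. i - 1 = 0) = ?C n (\<lambda>i. i = 0) \<union> ?C n (\<lambda>i. i = 1)" by auto
    then have "card (?C n (\<lambda>i. i - 1 = 0)) = card (?C n (\<lambda>i. i = 0)) + card (?C n (\<lambda>i. i = 1))"
      using fin by (simp only:, subst card_Un_disjoint) auto
    also have "\<dots> = (n choose ((n + 1) div 2)) + (n choose ((n + 2) div 2))"
      by (simp add: Suc.IH)
    also have "\<dots> = Suc n choose ((n + 2) div 2)"
    \<comment> \<open>For even \<open>n\<close> this is Pascal's rule. For odd \<open>n\<close> both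
      summands are the same middle coefficient, and symmetry replaces one of them by its
      neighbour.\<close>
    proof (cases "even n")
      case True
      then obtain m where "n = 2 * m" by auto
      then show ?thesis by simp
    next
      case False
      then obtain m where n: "n = 2 * m + 1" by (rule oddE)
      have "2 * m + 1 choose m = 2 * m + 1 choose (m + 1)"
        using binomial_symmetric[of m "2 * m + 1"] by simp
      then show ?thesis by (simp add: n)
    qed
    finally show ?thesis using 0 by simp
  next
    case (Suc i)
    have "?C n (\<lambda>k. k - 1 = Suc i) = ?C n (\<lambda>k. k = Suc (Suc i))" by auto
    then have "card (?C n (\<lambda>k. Suc k = j)) + card (?C n (\<lambda>k. k - 1 = j)) =
      (n choose ((n + i + 1) div 2)) + (n choose ((n + Suc (Suc i) + 1) div 2))"
      by (simp only: Suc Suc.IH nat.inject)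
    also have "\<dots> = Suc n choose ((Suc n + j + 1) div 2)" by (simp add: Suc)
    finally show ?thesis .
  qed
  finally show ?case .
qed

lemma card_words_level_le:
  "card {w. length w = n \<and> fold level_step w 0 \<le> K} \<le> (K + 1) * (n choose (n div 2))"
proof -
  let ?C = "\<lambda>j. {w. length w = n \<and> fold level_step w 0 = j}"
  have "{w. length w = n \<and> fold level_step w 0 \<le> K} = (\<Union>j\<in>{..K}. ?C j)" by auto
  then have "card {w. length w = n \<and> fold level_step w 0 \<le> K} \<le> (\<Sum>j\<le>K. card (?C j))"
    using card_UN_le[of "{..K}" ?C] by simp
  also have "\<dots> \<le> (\<Sum>j\<le>K. n choose (n div 2))"
    unfolding card_words_level by (intro sum_mono binomial_maximum)
  finally show ?thesis by simp
qed

text \<open>The bound \<open>4^m / sqrt (2 m + 1)\<close> for the central coefficient, squared to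
  stay within the naturals. The induction rests on \<open>(m + 1) * (2 * m + 2 choose (m + 1)) = 2 *
  (2 * m + 1) * (2 * m choose m)\<close> and
  \<open>(2 * m + 1) * (2 * m + 3) \<le> 4 * (m + 1)\<^sup>2\<close>.\<close>

lemma central_binomial_square_le: "(2 * m choose m)\<^sup>2 * (2 * m + 1) \<le> 16 ^ m"
proof (induction m)
  case (Suc m)
  let ?c = "2 * m choose m"
  have 1: "(2 * m + 1) * ?c = (2 * m + 1 choose (m + 1)) * (m + 1)"
    using Suc_times_binomial_eq[of "2 * m" m] by simp
  have 2: "(2 * m + 2) * (2 * m + 1 choose m) = (2 * m + 2 choose (m + 1)) * (m + 1)"
    using Suc_times_binomial_eq[of "2 * m + 1" m] by simp
  have 3: "2 * m + 1 choose m = 2 * m + 1 choose (m + 1)"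
    using binomial_symmetric[of m "2 * m + 1"] by simp
  have "(2 * m + 2 choose (m + 1)) * (m + 1) = (2 * (2 * m + 1 choose (m + 1))) * (m + 1)"
    using 2 3 by (simp add: algebra_simps)
  then have "2 * m + 2 choose (m + 1) = 2 * (2 * m + 1 choose (m + 1))" by (simp only: mult_cancel2) simp
  with 1 have c: "(m + 1) * (2 * m + 2 choose (m + 1)) = 2 * (2 * m + 1) * ?c"
    by (simp only: mult_ac)
  have "(m + 1)\<^sup>2 * ((2 * m + 2 choose (m + 1))\<^sup>2 * (2 * m + 3)) =
    ((m + 1) * (2 * m + 2 choose (m + 1)))\<^sup>2 * (2 * m + 3)" by (simp only: power_mult_distrib mult_ac)
  also have "\<dots> = (?c\<^sup>2 * (2 * m + 1)) * (4 * ((2 * m + 1) * (2 * m + 3)))"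
    unfolding c by (simp add: power2_eq_square algebra_simps)
  also have "\<dots> \<le> 16 ^ m * (16 * (m + 1)\<^sup>2)"
    by (rule mult_mono[OF Suc.IH]) (simp_all add: power2_eq_square algebra_simps)
  finally have "(m + 1)\<^sup>2 * ((2 * m + 2 choose (m + 1))\<^sup>2 * (2 * m + 3)) \<le> (m + 1)\<^sup>2 * 16 ^ Suc m"
    by (simp add: mult_ac)
  then have "(2 * m + 2 choose (m + 1))\<^sup>2 * (2 * m + 3) \<le> 16 ^ Suc m"
    by (simp only: mult_le_cancel1) simp
  then show ?case by (simp add: numeral_eq_Suc)
qed simp

lemma central_binomial_ln_le: "ln (real (2 * m choose m)) \<le> real (2 * m) * ln 2 - ln (real (2 * m + 1)) / 2"
proof -
  have pos: "0 < 2 * m choose m" by (simp add: zero_less_binomial)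
  have "2 * ln (real (2 * m choose m)) + ln (real (2 * m + 1)) =
    ln (real ((2 * m choose m)\<^sup>2 * (2 * m + 1)))"
    unfolding of_nat_mult of_nat_power using pos by (subst ln_mult) (simp_all add: ln_realpow)
  also have "\<dots> \<le> ln (real (16 ^ m))"
  proof (rule ln_mono)
    show "0 < real ((2 * m choose m)\<^sup>2 * (2 * m + 1))" unfolding of_nat_0_less_iff using pos by simp
    show "real ((2 * m choose m)\<^sup>2 * (2 * m + 1)) \<le> real (16 ^ m)"
      unfolding of_nat_le_iff by (rule central_binomial_square_le)
  qed
  also have "real (16 ^ m) = 2 ^ (4 * m)" by (simp add: power_mult)
  also have "ln (2 ^ (4 * m)) = real (4 * m) * ln (2 :: real)" by (simp add: ln_realpow)
  finally show ?thesis by simp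
qed

text \<open>Full entropy forces the itinerary of length \<open>n\<close> to be almost uniformly distributed, but only a
  vanishing proportion of the words keeps the reflected random walk below a given level.\<close>

lemma prob_height_eq_0:
  assumes \<mu>: "\<mu> \<in> invariant_prob_measures unit_square cone_map"
    and full: "\<And>n. real n * ln 2 \<le> prob_space.shannon \<mu> (itinerary cone_map low n)"
  shows "measure \<mu> {p \<in> space \<mu>. (1 / 2) ^ K \<le> snd p} = 0"
proof (rule ccontr)
  interpret mpt \<mu> cone_map by (rule mpt_invariant_prob_measures[OF \<mu>])
  note space = space_invariant_prob_measures[OF \<mu>]
  define a where "a = prob {p \<in> space \<mu>. (1 / 2) ^ K \<le> snd p}"
  assume "prob {p \<in> space \<mu>. (1 / 2) ^ K \<le> snd p} \<noteq> 0"
  then have a: "0 < a" by (simp add: a_def zero_less_measure_iff)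
  let ?V = "\<lambda>p. (1 / 2) ^ K \<le> snd p"
  have V: "simple_function \<mu> ?V"
    using \<mu> by (intro simple_functionI_borel[of _ unit_square])
      (auto simp: invariant_prob_measures_def borel_prod[symmetric])
  \<comment> \<open>By invariance the height at time \<open>2 * m\<close> is at least
    \<open>(1 / 2) ^ K\<close> with probability \<open>a\<close>, and then at most
    \<open>K + 1\<close> levels, hence at most \<open>K + 1\<close> times the central coefficient
    many words, remain. The deficit of \<open>a * ln (sqrt (2 * m + 1))\<close> up to a constant has
    to be covered by the \<open>ln 2\<close> paid for the event; it is unbounded in \<open>m\<close>
    if \<open>0 < a\<close>.\<close>
  have main: "a * (ln (real (2 * m + 1)) / 2 - ln (real (K + 1))) \<le> ln 2" for m
  proof -
    let ?X = "itinerary cone_map low (2 * m)" and ?c = "2 * m choose m"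
    let ?Vn = "\<lambda>p. ?V ((cone_map ^^ (2 * m)) p)"
    have "{p \<in> space \<mu>. ?Vn p} = (cone_map ^^ (2 * m)) -` {p \<in> space \<mu>. ?V p} \<inter> space \<mu>"
      using T_pow_space by auto
    moreover have "{p \<in> space \<mu>. ?V p} = ?V -` {True} \<inter> space \<mu>" by auto
    then have "{p \<in> space \<mu>. ?V p} \<in> sets \<mu>" using simple_functionD(2)[OF V] by simp
    ultimately have pa: "prob {p \<in> space \<mu>. ?Vn p} = a"
      using prob_T_pow[of "{p \<in> space \<mu>. ?V p}" "2 * m"] by (simp only: a_def)
    have "shannon ?X \<le> ln 2 + prob {p \<in> space \<mu>. ?Vn p} * ln (real ((K + 1) * ?c)) +
      (1 - prob {p \<in> space \<mu>. ?Vn p}) * ln (real (2 ^ (2 * m)))"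
    proof (intro shannon_le_two_fibres simple_function_itinerary simple_function_low[OF \<mu>]
        simple_function_T_pow[OF V] card_low_itineraries_le)
      have "fold level_step (?X p) 0 \<le> K" if "p \<in> space \<mu>" "?Vn p" for p
      proof -
        have "(1 / 2 :: real) ^ K \<le> (1 / 2) ^ fold level_step (?X p) 0"
          using that space by (intro order_trans[OF that(2) snd_cone_map_pow_le]) simp
        then show ?thesis by (subst (asm) power_decreasing_iff) simp_all
      qed
      then have "card (?X ` {p \<in> space \<mu>. ?Vn p}) \<le> card {w. length w = 2 * m \<and> fold level_step w 0 \<le> K}"
        by (intro card_mono finite_subset[OF _ finite_bool_lists[of "2 * m"]]) auto
      also have "\<dots> \<le> (K + 1) * ?c" using card_words_level_le[of "2 * m" K] by simp
      finally show "card (?X ` {p \<in> space \<mu>. ?Vn p}) \<le> (K + 1) * ?c" .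
    qed
    with full[of "2 * m"] have "real (2 * m) * ln 2 \<le> ln 2 + a * ln (real ((K + 1) * ?c)) + (1 - a) * ln (real (2 ^ (2 * m)))"
      unfolding pa by linarith
    also have "ln (real (2 ^ (2 * m))) = real (2 * m) * ln 2" by (simp add: ln_realpow)
    also have "ln (real ((K + 1) * ?c)) = ln (real (K + 1)) + ln (real ?c)"
      unfolding of_nat_mult by (subst ln_mult) (simp_all add: zero_less_binomial)
    finally have "a * (real (2 * m) * ln 2 - ln (real (K + 1)) - ln (real ?c)) \<le> ln 2"
      by (simp add: algebra_simps)
    moreover have "a * (ln (real (2 * m + 1)) / 2 - ln (real (K + 1))) \<le>
      a * (real (2 * m) * ln 2 - ln (real (K + 1)) - ln (real ?c))"
      using a central_binomial_ln_le[of m] by (intro mult_left_mono) auto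
    ultimately show ?thesis by linarith
  qed
  have "filterlim (\<lambda>m. a * (ln (real (2 * m + 1)) / 2 - ln (real (K + 1)))) at_top sequentially"
    using a by real_asymp
  then have "\<forall>\<^sub>F m in sequentially. ln 2 < a * (ln (real (2 * m + 1)) / 2 - ln (real (K + 1)))"
    by (simp add: filterlim_at_top_dense)
  then obtain m where "ln 2 < a * (ln (real (2 * m + 1)) / 2 - ln (real (K + 1)))"
    by (auto simp: eventually_sequentially)
  with main[of m] show False by linarith
qed

text \<open>The bottom side reaches the fixed point at the origin, which is \<open>low\<close>, in
  one step, so only the first letter is free.\<close>

lemma low_itinerary_height_0:
  assumes "p \<in> unit_square" "snd p = 0"
  shows "itinerary cone_map low 3 p \<in> {[True, True, True], [False, True, True]}"
proof -
  have "cone_map p = (0, 0)" using assms by (cases p) (auto simp: cone_map_def mem_unit_square)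
  moreover have "cone_map (0, 0) = (0, 0)" by (simp add: cone_map_def)
  moreover have "low (0, 0)" by (simp add: low_def)
  ultimately show ?thesis by (cases "low p") (simp_all add: itinerary_def upt_rec numeral_eq_Suc)
qed

lemma ks_entropy_cone_map_neq:
  assumes \<mu>: "\<mu> \<in> invariant_prob_measures unit_square cone_map"
  shows "ks_entropy cone_map \<mu> \<noteq> ereal (ln 2)"
proof
  interpret mpt \<mu> cone_map by (rule mpt_invariant_prob_measures[OF \<mu>])
  note space = space_invariant_prob_measures[OF \<mu>]
  assume "ks_entropy cone_map \<mu> = ereal (ln 2)"
  then have rate: "ereal (ln 2) \<le> rate low" using ks_entropy_le_rate_low[OF \<mu>] by simp
  \<comment> \<open>The rate is at most the normalized entropy of every word length, so a rate of
    \<open>ln 2\<close> makes each of them full.\<close>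
  have full: "real n * ln 2 \<le> shannon (itinerary cone_map low n)" for n
  proof (cases "n = 0")
    case False
    then have "ereal (ln 2) \<le> ereal (shannon (itinerary cone_map low n) / real n)"
      using rate_le_shannon[OF simple_function_low[OF \<mu>], of n] by (intro order_trans[OF rate]) simp
    then show ?thesis using False by (simp add: field_simps)
  qed (simp add: shannon_nonneg)
  let ?V = "\<lambda>p. 0 < snd p"
  have V: "simple_function \<mu> ?V"
    using \<mu> by (intro simple_functionI_borel[of _ unit_square])
      (auto simp: invariant_prob_measures_def borel_prod[symmetric])
  have "{p \<in> space \<mu>. ?V p} = (\<Union>K. {p \<in> space \<mu>. (1 / 2) ^ K \<le> snd p})" (is "_ = (\<Union>K. ?A K)")
  proof (intro equalityI subsetI)
    fix p assume "p \<in> {p \<in> space \<mu>. ?V p}"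
    moreover from this obtain K where "(1 / 2) ^ K < snd p"
      using real_arch_pow_inv[of "snd p" "1 / 2"] by auto
    ultimately show "p \<in> (\<Union>K. ?A K)" by (auto intro: less_imp_le)
  next
    fix p assume "p \<in> (\<Union>K. ?A K)"
    then obtain K where "p \<in> space \<mu>" "(1 / 2) ^ K \<le> snd p" by auto
    moreover have "0 < (1 / 2 :: real) ^ K" by simp
    ultimately have "0 < snd p" by linarith
    with \<open>p \<in> space \<mu>\<close> show "p \<in> {p \<in> space \<mu>. ?V p}" by simp
  qed
  moreover have "?A K \<in> null_sets \<mu>" for K
  proof -
    have "simple_function \<mu> (\<lambda>p. (1 / 2) ^ K \<le> snd p)"
      using \<mu> by (intro simple_functionI_borel[of _ unit_square])
        (auto simp: invariant_prob_measures_def borel_prod[symmetric])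
    moreover have "?A K = (\<lambda>p. (1 / 2) ^ K \<le> snd p) -` {True} \<inter> space \<mu>" by auto
    ultimately have "?A K \<in> sets \<mu>" using simple_functionD(2) by simp
    then show ?thesis using prob_height_eq_0[OF \<mu> full, of K]
      by (simp add: null_sets_def emeasure_eq_measure)
  qed
  ultimately have "{p \<in> space \<mu>. ?V p} \<in> null_sets \<mu>" by (simp only: null_sets_UN)
  then have 0: "prob {p \<in> space \<mu>. ?V p} = 0" by (simp add: null_sets_def measure_def)
  \<comment> \<open>The right-hand side amounts to \<open>2 * ln 2\<close>: one \<open>ln 2\<close>
    for the bit \<open>?V\<close> and one for the two words at height 0. Length 3 is the first one
    to contradict \<open>full\<close>.\<close>
  have "shannon (itinerary cone_map low 3) \<le> ln 2 + prob {p \<in> space \<mu>. ?V p} * ln (real (2 ^ 3)) +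
    (1 - prob {p \<in> space \<mu>. ?V p}) * ln (real 2)"
  proof (intro shannon_le_two_fibres simple_function_itinerary simple_function_low[OF \<mu>] V card_low_itineraries_le)
    have "itinerary cone_map low 3 ` {p \<in> space \<mu>. \<not> ?V p} \<subseteq> {[True, True, True], [False, True, True]}"
      by (intro image_subsetI low_itinerary_height_0) (auto simp: space mem_unit_square)
    then have "card (itinerary cone_map low 3 ` {p \<in> space \<mu>. \<not> ?V p}) \<le> card {[True, True, True], [False, True, True]}"
      by (intro card_mono) auto
    then show "card (itinerary cone_map low 3 ` {p \<in> space \<mu>. \<not> ?V p}) \<le> 2" by simp
  qed
  moreover have "0 < ln (2 :: real)" by simp
  ultimately show False using full[of 3] 0 by simp
qed

section \<open>Measures of almost maximal entropy\<close>

definition level_shift :: "nat \<times> bool stream \<Rightarrow> nat \<times> bool stream" where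
  "level_shift s = (level_step (shd (snd s)) (fst s), stl (snd s))"

text \<open>Applies the inverse branches \<open>x = x' / 2\<close> and \<open>x = y - x' / 4\<close>
  along the first \<open>n\<close> letters, starting from 0 at the far end; the height
  \<open>y\<close> is known from the level.\<close>

primrec approx_x :: "nat \<Rightarrow> nat \<times> bool stream \<Rightarrow> real" where
  "approx_x 0 s = 0"
| "approx_x (Suc n) s = (if shd (snd s) then approx_x n (level_shift s) / 2
     else (1 / 2) ^ fst s - approx_x n (level_shift s) / 4)"

definition limit_x :: "nat \<times> bool stream \<Rightarrow> real" where
  "limit_x s = lim (\<lambda>n. approx_x n s)"

text \<open>The point at height exactly \<open>(1 / 2) ^ fst s\<close> whose orbit never leaves the
  two branches and whose letters are the given stream.\<close>

definition symbolic_point :: "nat \<times> bool stream \<Rightarrow> real \<times> real" where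
  "symbolic_point s = (limit_x s, (1 / 2) ^ fst s)"

lemma half_power_level_step:
  "(1 / 2 :: real) ^ level_step b j = (if b then (1 / 2) ^ j / 2 else min 1 (2 * (1 / 2) ^ j))"
proof (cases j)
  case (Suc k)
  have "(1 / 2 :: real) ^ k \<le> 1" by (simp add: power_le_one)
  then show ?thesis using Suc by (simp add: level_step_def)
qed (simp add: level_step_def)

lemma approx_x_bounds: "0 \<le> approx_x n s \<and> approx_x n s \<le> (1 / 2) ^ fst s"
proof (induction n arbitrary: s)
  case (Suc n)
  from Suc[of "level_shift s"] show ?case
    by (auto simp: level_shift_def half_power_level_step)
qed simp

text \<open>Both inverse branches contract by at least \<open>1/2\<close>, and the first error is at
  most 1.\<close>

lemma approx_x_step: "\<bar>approx_x (Suc n) s - approx_x n s\<bar> \<le> (1 / 2) ^ n"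
proof (induction n arbitrary: s)
  case 0
  have "approx_x (Suc 0) s \<le> (1 / 2) ^ fst s" "0 \<le> approx_x (Suc 0) s"
    using approx_x_bounds by blast+
  moreover have "(1 / 2 :: real) ^ fst s \<le> 1" by (simp add: power_le_one)
  ultimately show ?case by (simp del: approx_x.simps(2))
next
  case (Suc n)
  have "\<bar>approx_x (Suc (Suc n)) s - approx_x (Suc n) s\<bar> \<le>
    \<bar>approx_x (Suc n) (level_shift s) - approx_x n (level_shift s)\<bar> / 2"
    by (subst (1 2) approx_x.simps(2)) (auto simp: abs_if simp del: approx_x.simps(2))
  also have "\<dots> \<le> (1 / 2) ^ Suc n" using Suc[of "level_shift s"] by simp
  finally show ?case .
qed

lemma approx_x_tendsto: "(\<lambda>n. approx_x n s) \<longlonglongrightarrow> limit_x s"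
proof -
  have "summable (\<lambda>n. approx_x (Suc n) s - approx_x n s)"
    by (rule summable_comparison_test'[where g = "\<lambda>n. (1 / 2) ^ n" and N = 0])
      (use approx_x_step in \<open>auto simp del: approx_x.simps(2)\<close>)
  then have "convergent (\<lambda>n. \<Sum>i<n. approx_x (Suc i) s - approx_x i s)"
    by (simp add: summable_iff_convergent del: approx_x.simps(2))
  then have "convergent (\<lambda>n. approx_x n s)"
    unfolding sum_lessThan_telescope[of "\<lambda>n. approx_x n s"] by simp
  then show ?thesis by (simp add: limit_x_def convergent_LIMSEQ_iff)
qed

lemma limit_x_bounds: "0 \<le> limit_x s" "limit_x s \<le> (1 / 2) ^ fst s"
  using approx_x_bounds[of _ s]
  by (blast intro: LIMSEQ_le_const[OF approx_x_tendsto] LIMSEQ_le_const2[OF approx_x_tendsto])+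

lemma limit_x_level_shift:
  "limit_x s = (if shd (snd s) then limit_x (level_shift s) / 2
     else (1 / 2) ^ fst s - limit_x (level_shift s) / 4)"
proof (rule LIMSEQ_unique[OF approx_x_tendsto[THEN LIMSEQ_Suc]])
  show "(\<lambda>n. approx_x (Suc n) s) \<longlonglongrightarrow> (if shd (snd s) then limit_x (level_shift s) / 2
     else (1 / 2) ^ fst s - limit_x (level_shift s) / 4)"
    by (auto intro!: tendsto_intros approx_x_tendsto)
qed

lemma symbolic_point_mem: "symbolic_point s \<in> unit_square"
proof -
  have "(1 / 2 :: real) ^ fst s \<le> 1" by (simp add: power_le_one)
  with limit_x_bounds[of s] show ?thesis by (simp add: symbolic_point_def mem_unit_square)
qed

lemma symbolic_point_bounds:
  "shd (snd s) \<Longrightarrow> 4 * limit_x s \<le> (1 / 2) ^ fst s"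
  "\<not> shd (snd s) \<Longrightarrow> (1 / 2) ^ fst s \<le> 2 * limit_x s"
  using limit_x_bounds[of "level_shift s"] limit_x_level_shift[of s]
  by (auto simp: level_shift_def half_power_level_step)

lemma low_symbolic_point: "low (symbolic_point s) \<longleftrightarrow> shd (snd s)"
proof (cases "shd (snd s)")
  case True
  then show ?thesis using symbolic_point_bounds(1)[of s] by (simp add: low_def symbolic_point_def)
next
  case False
  have "0 < (1 / 2 :: real) ^ fst s" by simp
  then have "\<not> 4 * limit_x s \<le> (1 / 2) ^ fst s"
    using symbolic_point_bounds(2)[OF False] by linarith
  then show ?thesis using False by (simp add: low_def symbolic_point_def)
qed

lemma cone_map_symbolic_point: "cone_map (symbolic_point s) = symbolic_point (level_shift s)"
proof (cases "shd (snd s)")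
  case True
  have "cone_map (symbolic_point s) = (2 * limit_x s, (1 / 2) ^ fst s / 2)"
    using cone_map_low[OF symbolic_point_mem, of s] True low_symbolic_point[of s]
    by (simp only: symbolic_point_def fst_conv snd_conv)
  also have "\<dots> = symbolic_point (level_shift s)"
    using True limit_x_level_shift[of s] half_power_level_step[of True "fst s"]
    by (simp add: symbolic_point_def level_shift_def)
  finally show ?thesis .
next
  case False
  have x: "limit_x (level_shift s) = 4 * ((1 / 2) ^ fst s - limit_x s)"
    using False limit_x_level_shift[of s] by simp
  \<comment> \<open>The image lies in the square; by \<open>x\<close> this is the statement that the
    point itself is in the unclipped part of the doubling branch.\<close>
  have "limit_x (level_shift s) \<le> 1"
    using symbolic_point_mem[of "level_shift s"] by (simp add: mem_unit_square symbolic_point_def)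
  then have "cone_map (symbolic_point s) = (4 * ((1 / 2) ^ fst s - limit_x s), min 1 (2 * (1 / 2) ^ fst s))"
    using cone_map_high[OF symbolic_point_mem[of s]] False x symbolic_point_bounds(2)[of s] limit_x_bounds[of s]
    by (simp add: symbolic_point_def)
  also have "\<dots> = symbolic_point (level_shift s)"
    using False x half_power_level_step[of False "fst s"]
    by (simp add: symbolic_point_def level_shift_def)
  finally show ?thesis .
qed

lemma cone_map_pow_symbolic_point: "(cone_map ^^ k) (symbolic_point s) = symbolic_point ((level_shift ^^ k) s)"
  by (induction k) (simp_all add: cone_map_symbolic_point)

lemma level_shift_pow: "(level_shift ^^ k) s = (fold level_step (stake k (snd s)) (fst s), sdrop k (snd s))"
proof (induction k arbitrary: s)
  case (Suc k)
  have "(level_shift ^^ Suc k) s = (level_shift ^^ k) (level_shift s)" by (simp add: funpow_swap1)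
  also have "\<dots> = (fold level_step (stake (Suc k) (snd s)) (fst s), sdrop (Suc k) (snd s))"
    unfolding Suc by (simp add: level_shift_def)
  finally show ?case .
qed simp

lemma itinerary_symbolic_point: "itinerary cone_map low n (symbolic_point s) = stake n (snd s)"
  by (rule nth_equalityI)
    (simp_all add: cone_map_pow_symbolic_point level_shift_pow low_symbolic_point)

section \<open>Measurability of the symbolic coding\<close>

abbreviation symbolic_space :: "(nat \<times> bool stream) measure" where
  "symbolic_space \<equiv> count_space UNIV \<Otimes>\<^sub>M stream_space (count_space UNIV)"

lemma measurable_level_shift [measurable]: "level_shift \<in> measurable symbolic_space symbolic_space"
proof (rule measurable_pair_measure_countable1)
  fix j :: nat
  have "(\<lambda>\<omega>. level_step (shd \<omega>) j) \<in> measurable (stream_space (count_space UNIV)) (count_space UNIV)"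
    by (rule measurable_compose[OF measurable_shd]) simp
  then show "(\<lambda>\<omega>. level_shift (j, \<omega>)) \<in> measurable (stream_space (count_space UNIV)) symbolic_space"
    unfolding level_shift_def by simp
qed simp

lemma measurable_approx_x [measurable]: "approx_x n \<in> borel_measurable symbolic_space"
proof (induction n)
  case (Suc n)
  note [measurable] = Suc
  have [measurable]: "Measurable.pred symbolic_space (\<lambda>s. shd (snd s))"
    by (rule measurable_compose[OF measurable_snd measurable_shd])
  have [measurable]: "(\<lambda>s. (1 / 2 :: real) ^ fst s) \<in> borel_measurable symbolic_space"
    by (rule measurable_compose[OF measurable_fst]) simp
  show ?case unfolding approx_x.simps by measurable
qed simp

lemma measurable_symbolic_point:
  "symbolic_point \<in> measurable symbolic_space (restrict_space borel unit_square)"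
proof (rule measurable_restrict_space2)
  have [measurable]: "limit_x \<in> borel_measurable symbolic_space"
    by (rule borel_measurable_LIMSEQ_real[OF approx_x_tendsto measurable_approx_x])
  have [measurable]: "(\<lambda>s. (1 / 2 :: real) ^ fst s) \<in> borel_measurable symbolic_space"
    by (rule measurable_compose[OF measurable_fst]) simp
  show "symbolic_point \<in> borel_measurable symbolic_space"
    unfolding symbolic_point_def[abs_def] borel_prod[symmetric] by measurable
qed (use symbolic_point_mem in auto)

lemma bool_words_Suc:
  "{w :: bool list. length w = Suc n} = (#) True ` {w. length w = n} \<union> (#) False ` {w. length w = n}"
  by (auto simp: length_Suc_conv image_iff)

lemma sum_bool_words_Suc:
  "(\<Sum>w\<in>{w :: bool list. length w = Suc n}. f w) =
   (\<Sum>w\<in>{w. length w = n}. f (True # w)) + (\<Sum>w\<in>{w. length w = n}. f (False # w))"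
  unfolding bool_words_Suc
  by (subst sum.union_disjoint) (auto simp: finite_bool_lists sum.reindex inj_on_def)

section \<open>Stationary reflected walk and its image measure\<close>

context
  fixes p :: real
  assumes p: "0 < p" "p < 1 / 2"
begin

text \<open>Balance between levels \<open>j\<close> and \<open>j + 1\<close> requires the weights to
  decrease by the ratio \<open>p / (1 - p)\<close>, which is below 1 exactly because the walk drifts
  towards 0. The parameter is 1 minus this ratio.\<close>

definition level_pmf :: "nat pmf" where
  "level_pmf = geometric_pmf ((1 - 2 * p) / (1 - p))"

definition walk_measure :: "(nat \<times> bool stream) measure" where
  "walk_measure = measure_pmf level_pmf \<Otimes>\<^sub>M stream_space (measure_pmf (bernoulli_pmf p))"

lemma pmf_level: "pmf level_pmf n = (p / (1 - p)) ^ n * ((1 - 2 * p) / (1 - p))"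
proof -
  have "0 < (1 - 2 * p) / (1 - p)" "(1 - 2 * p) / (1 - p) \<le> 1" using p by simp_all
  moreover have "1 - (1 - 2 * p) / (1 - p) = p / (1 - p)" using p by (simp add: field_simps)
  ultimately show ?thesis by (simp add: level_pmf_def)
qed

text \<open>Level 0 is entered from 0, by reflection, and from 1; a level \<open>Suc k\<close> is
  entered from its two neighbours.\<close>

lemma level_pmf_stationary:
  "map_pmf (\<lambda>(j, b). level_step b j) (pair_pmf level_pmf (bernoulli_pmf p)) = level_pmf" (is "?L = _")
proof (rule pmf_eqI)
  fix i
  define r c where "r = p / (1 - p)" and "c = (1 - 2 * p) / (1 - p)"
  have r: "r * (1 - p) = p" using p by (simp add: r_def)
  then have rp: "p + r * p = r" by (simp add: algebra_simps)
  have pmf: "pmf level_pmf n = r ^ n * c" for n by (simp add: pmf_level r_def c_def)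
  have "pmf ?L i = measure (measure_pmf (pair_pmf level_pmf (bernoulli_pmf p))) ((\<lambda>(j, b). level_step b j) -` {i})"
    by (rule pmf_map)
  also have "\<dots> = pmf level_pmf i"
  proof (cases i)
    case 0
    have "(\<lambda>(j, b). level_step b j) -` {0} = {(0, False), (1, False)}"
      by (auto simp: level_step_def split: if_splits)
    then have "measure (measure_pmf (pair_pmf level_pmf (bernoulli_pmf p))) ((\<lambda>(j, b). level_step b j) -` {0}) =
      c * (1 - p) + r * c * (1 - p)"
      using p by (simp add: measure_measure_pmf_finite pmf_pair pmf)
    also have "\<dots> = c * (1 - p) + c * (r * (1 - p))" by (simp only: mult_ac)
    also have "\<dots> = c" unfolding r by (simp add: algebra_simps)
    finally show ?thesis using 0 by (simp add: pmf)
  next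
    case (Suc k)
    have "(\<lambda>(j, b). level_step b j) -` {Suc k} = {(k, True), (Suc (Suc k), False)}"
      by (auto simp: level_step_def split: if_splits)
    then have "measure (measure_pmf (pair_pmf level_pmf (bernoulli_pmf p))) ((\<lambda>(j, b). level_step b j) -` {Suc k}) =
      r ^ k * c * p + r * (r * r ^ k) * c * (1 - p)"
      using p by (simp add: measure_measure_pmf_finite pmf_pair pmf)
    also have "\<dots> = (r ^ k * c) * (p + r * (r * (1 - p)))" by (simp only: distrib_left mult_ac)
    also have "\<dots> = r * r ^ k * c" unfolding r rp by (simp only: mult_ac)
    finally show ?thesis using Suc by (simp add: pmf)
  qed
  finally show "pmf ?L i = pmf level_pmf i" .
qed

lemma sets_walk_measure [measurable_cong]: "sets walk_measure = sets symbolic_space"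
  unfolding walk_measure_def by (intro sets_pair_measure_cong sets_stream_space_cong) simp_all

lemma space_walk_measure [simp]: "space walk_measure = UNIV"
  by (simp add: walk_measure_def space_pair_measure space_stream_space)

lemma prob_space_walk_measure: "prob_space walk_measure"
  unfolding walk_measure_def
  by (intro prob_space_pair prob_space_measure_pmf prob_space.prob_space_stream_space[OF prob_space_measure_pmf])

text \<open>The new level depends on the old level and the first letter, both independent of the
  remaining letters. Integrating over that letter separately leaves the stationarity of the
  level.\<close>

lemma distr_walk_measure: "distr walk_measure walk_measure level_shift = walk_measure"
proof (rule measure_eqI)
  let ?B = "measure_pmf (bernoulli_pmf p)" and ?S = "stream_space (measure_pmf (bernoulli_pmf p))"
  interpret S: prob_space ?S by (rule prob_space.prob_space_stream_space[OF prob_space_measure_pmf])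
  have shift [measurable]: "level_shift \<in> measurable walk_measure walk_measure"
    using measurable_level_shift by (simp cong: measurable_cong_sets add: sets_walk_measure)
  fix A assume "A \<in> sets (distr walk_measure walk_measure level_shift)"
  then have A [measurable]: "A \<in> sets walk_measure" by simp
  have nn: "(\<integral>\<^sup>+s. f s \<partial>walk_measure) = (\<integral>\<^sup>+j. \<integral>\<^sup>+\<omega>. f (j, \<omega>) \<partial>?S \<partial>level_pmf)"
    if "f \<in> borel_measurable walk_measure" for f
    using that unfolding walk_measure_def by (subst S.nn_integral_fst) auto
  have slice: "(\<lambda>\<omega>. f (j, \<omega>)) \<in> borel_measurable ?S" if "f \<in> borel_measurable walk_measure"
    for f :: "_ \<Rightarrow> ennreal" and j
    using that unfolding walk_measure_def by measurable
  have "emeasure (distr walk_measure walk_measure level_shift) A =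
    (\<integral>\<^sup>+s. indicator A (level_shift s) \<partial>walk_measure)"
    by (subst nn_integral_indicator[symmetric]) (auto simp: nn_integral_distr simp del: nn_integral_indicator)
  also have "\<dots> = (\<integral>\<^sup>+j. \<integral>\<^sup>+\<omega>. indicator A (level_shift (j, \<omega>)) \<partial>?S \<partial>level_pmf)"
    by (rule nn) measurable
  also have "\<dots> = (\<integral>\<^sup>+j. \<integral>\<^sup>+b. \<integral>\<^sup>+\<omega>. indicator A (level_step b j, \<omega>) \<partial>?S \<partial>?B \<partial>level_pmf)"
  proof (intro nn_integral_cong)
    fix j
    have "(\<lambda>\<omega>. indicator A (level_shift (j, \<omega>)) :: ennreal) \<in> borel_measurable ?S"
      by (rule slice) measurable
    then show "(\<integral>\<^sup>+\<omega>. indicator A (level_shift (j, \<omega>)) \<partial>?S) = (\<integral>\<^sup>+b. \<integral>\<^sup>+\<omega>. indicator A (level_step b j, \<omega>) \<partial>?S \<partial>?B)"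
      by (subst prob_space.nn_integral_stream_space[OF prob_space_measure_pmf]) (simp_all add: level_shift_def)
  qed
  also have "\<dots> = (\<integral>\<^sup>+x. \<integral>\<^sup>+\<omega>. indicator A (case x of (j, b) \<Rightarrow> level_step b j, \<omega>) \<partial>?S \<partial>pair_pmf level_pmf (bernoulli_pmf p))"
    by (simp add: nn_integral_pair_pmf' del: nn_integral_bernoulli_pmf)
  also have "\<dots> = (\<integral>\<^sup>+i. \<integral>\<^sup>+\<omega>. indicator A (i, \<omega>) \<partial>?S \<partial>map_pmf (\<lambda>(j, b). level_step b j) (pair_pmf level_pmf (bernoulli_pmf p)))"
    by simp
  also have "\<dots> = (\<integral>\<^sup>+i. \<integral>\<^sup>+\<omega>. indicator A (i, \<omega>) \<partial>?S \<partial>level_pmf)"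
    by (simp only: level_pmf_stationary)
  also have "\<dots> = (\<integral>\<^sup>+s. indicator A s \<partial>walk_measure)"
    by (rule nn[symmetric]) measurable
  also have "\<dots> = emeasure walk_measure A" by simp
  finally show "emeasure (distr walk_measure walk_measure level_shift) A = emeasure walk_measure A" .
qed simp

definition cone_measure :: "(real \<times> real) measure" where
  "cone_measure = distr walk_measure (restrict_space borel unit_square) symbolic_point"

lemma measurable_symbolic_point_walk: "symbolic_point \<in> measurable walk_measure (restrict_space borel unit_square)"
  using measurable_symbolic_point by (simp cong: measurable_cong_sets add: sets_walk_measure)

lemma cone_measure_invariant: "cone_measure \<in> invariant_prob_measures unit_square cone_map"
proof -
  let ?R = "restrict_space borel unit_square :: (real \<times> real) measure"
  have T: "cone_map \<in> measurable ?R ?R"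
    using cone_map_mem by (intro measurable_restrict_space2 measurable_restrict_space1 borel_measurable_cone_map)
      (auto simp: space_restrict_space)
  have shift: "level_shift \<in> measurable walk_measure walk_measure"
    using measurable_level_shift by (simp cong: measurable_cong_sets add: sets_walk_measure)
  have "distr cone_measure cone_measure cone_map = distr cone_measure ?R cone_map"
    by (rule distr_cong) (simp_all add: cone_measure_def)
  also have "\<dots> = distr walk_measure ?R (cone_map \<circ> symbolic_point)"
    unfolding cone_measure_def by (rule distr_distr[OF T measurable_symbolic_point_walk])
  also have "cone_map \<circ> symbolic_point = symbolic_point \<circ> level_shift"
    by (auto simp: cone_map_symbolic_point)
  also have "distr walk_measure ?R (symbolic_point \<circ> level_shift) =
    distr (distr walk_measure walk_measure level_shift) ?R symbolic_point"
    by (rule distr_distr[OF measurable_symbolic_point_walk shift, symmetric])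
  also have "\<dots> = cone_measure" by (simp add: distr_walk_measure cone_measure_def)
  finally have "distr cone_measure cone_measure cone_map = cone_measure" .
  moreover have "prob_space cone_measure"
    unfolding cone_measure_def
    by (rule prob_space.prob_space_distr[OF prob_space_walk_measure measurable_symbolic_point_walk])
  moreover have "cone_map \<in> measurable cone_measure cone_measure"
    using T by (simp add: cone_measure_def)
  ultimately show ?thesis by (simp add: invariant_prob_measures_def cone_measure_def)
qed

definition word_prob :: "bool list \<Rightarrow> real" where
  "word_prob w = prod_list (map (pmf (bernoulli_pmf p)) w)"

lemma word_prob_simps [simp]:
  "word_prob [] = 1" "word_prob (b # w) = (if b then p else 1 - p) * word_prob w"
  using p by (simp_all add: word_prob_def)

lemma word_prob_pos: "0 < word_prob w"
  using p by (induction w) auto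

lemma sum_word_prob: "(\<Sum>w\<in>{w. length w = n}. word_prob w) = 1"
proof (induction n)
  case (Suc n)
  then show ?case by (simp add: sum_bool_words_Suc sum_distrib_left[symmetric])
qed simp

lemma word_entropy:
  "- (\<Sum>w\<in>{w. length w = n}. word_prob w * ln (word_prob w)) = real n * - (p * ln p + (1 - p) * ln (1 - p))"
proof (induction n)
  case (Suc n)
  have step: "(\<Sum>w\<in>{w. length w = n}. q * word_prob w * ln (q * word_prob w)) =
    q * ln q + q * (\<Sum>w\<in>{w. length w = n}. word_prob w * ln (word_prob w))" if "0 < q" for q
  proof -
    have "q * word_prob w * ln (q * word_prob w) = q * ln q * word_prob w + q * (word_prob w * ln (word_prob w))" for w
      using that word_prob_pos[of w] by (simp add: ln_mult algebra_simps)
    then have "(\<Sum>w\<in>{w. length w = n}. q * word_prob w * ln (q * word_prob w)) =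
      q * ln q * (\<Sum>w\<in>{w. length w = n}. word_prob w) + q * (\<Sum>w\<in>{w. length w = n}. word_prob w * ln (word_prob w))"
      by (simp add: sum.distrib sum_distrib_left)
    then show ?thesis by (simp add: sum_word_prob)
  qed
  let ?S = "\<Sum>w\<in>{w. length w = n}. word_prob w * ln (word_prob w)"
  have "0 < 1 - p" using p by simp
  then have "(\<Sum>w\<in>{w. length w = Suc n}. word_prob w * ln (word_prob w)) =
    (p * ln p + p * ?S) + ((1 - p) * ln (1 - p) + (1 - p) * ?S)"
    using p by (simp only: sum_bool_words_Suc word_prob_simps if_True if_False step)
  also have "\<dots> = (p * ln p + (1 - p) * ln (1 - p)) + ?S" by (simp add: algebra_simps)
  finally show ?case using Suc by (simp add: distrib_right)
qed simp

lemma measure_stake_eq: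
  "measure (stream_space (measure_pmf (bernoulli_pmf p))) {\<omega>. stake (length w) \<omega> = w} = word_prob w"
proof (induction w)
  case Nil
  interpret S: prob_space "stream_space (measure_pmf (bernoulli_pmf p))"
    by (rule prob_space.prob_space_stream_space[OF prob_space_measure_pmf])
  show ?case using S.prob_space by (simp add: space_stream_space)
next
  case (Cons b w)
  let ?S = "stream_space (measure_pmf (bernoulli_pmf p))"
  interpret S: prob_space ?S by (rule prob_space.prob_space_stream_space[OF prob_space_measure_pmf])
  have "stake (length (b # w)) \<in> measurable ?S (count_space UNIV)"
    using measurable_stake[of "length (b # w)"] by (simp cong: measurable_cong_sets sets_stream_space_cong)
  then have "{\<omega>. stake (length (b # w)) \<omega> = b # w} \<in> sets ?S"
    using measurable_sets[of "stake (length (b # w))" ?S "count_space UNIV" "{b # w}"]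
    by (simp add: space_stream_space vimage_def)
  then have "ennreal (measure ?S {\<omega>. stake (length (b # w)) \<omega> = b # w}) =
    (\<integral>\<^sup>+t. measure ?S {\<omega>. stake (length (b # w)) (t ## \<omega>) = b # w} \<partial>bernoulli_pmf p)"
    using prob_space.prob_stream_space[OF prob_space_measure_pmf, of "bernoulli_pmf p" "\<lambda>\<omega>. stake (length (b # w)) \<omega> = b # w"]
    by (simp add: space_stream_space del: nn_integral_bernoulli_pmf)
  also have "\<dots> = ennreal (word_prob (b # w))"
    using p Cons word_prob_pos[of w] by (cases b) (simp_all add: ennreal_mult' mult.commute)
  finally show ?case using word_prob_pos[of "b # w"] by (simp del: word_prob_simps)
qed

lemma measure_itinerary_eq:
  assumes "length w = n"
  shows "measure cone_measure (itinerary cone_map low n -` {w} \<inter> space cone_measure) = word_prob w"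
proof -
  let ?S = "stream_space (measure_pmf (bernoulli_pmf p))"
  interpret S: prob_space ?S by (rule prob_space.prob_space_stream_space[OF prob_space_measure_pmf])
  interpret mpt cone_measure cone_map by (rule mpt_invariant_prob_measures[OF cone_measure_invariant])
  have sets: "itinerary cone_map low n -` {w} \<inter> space cone_measure \<in> sets cone_measure"
    using simple_function_itinerary[OF simple_function_low[OF cone_measure_invariant]] by (rule simple_functionD)
  have st: "{\<omega>. stake n \<omega> = w} \<in> sets ?S"
  proof -
    have "stake n \<in> measurable ?S (count_space UNIV)"
      using measurable_stake[of n] by (simp cong: measurable_cong_sets sets_stream_space_cong)
    then show ?thesis
      using measurable_sets[of "stake n" ?S "count_space UNIV" "{w}"]
      by (simp add: space_stream_space vimage_def)
  qed
  have "measure cone_measure (itinerary cone_map low n -` {w} \<inter> space cone_measure) =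
    measure walk_measure (symbolic_point -` (itinerary cone_map low n -` {w} \<inter> space cone_measure) \<inter> space walk_measure)"
    using sets measurable_symbolic_point_walk unfolding cone_measure_def by (intro measure_distr) simp_all
  also have "symbolic_point -` (itinerary cone_map low n -` {w} \<inter> space cone_measure) \<inter> space walk_measure =
    UNIV \<times> {\<omega>. stake n \<omega> = w}"
    by (rule set_eqI) (simp add: itinerary_symbolic_point symbolic_point_mem mem_Times_iff
        space_invariant_prob_measures[OF cone_measure_invariant])
  also have "measure walk_measure \<dots> = measure ?S {\<omega>. stake n \<omega> = w}"
    unfolding walk_measure_def using st by (simp add: measure_def S.emeasure_pair_measure_Times)
  also have "\<dots> = word_prob w" using measure_stake_eq[of w] assms by simp
  finally show ?thesis .
qed

text \<open>Under \<open>cone_measure\<close> the letters are independent with weights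
  \<open>p\<close> and \<open>1 - p\<close>, so words of length \<open>n\<close> have exactly
  \<open>n\<close> times the entropy of one letter. The partition into \<open>low\<close> and its
  complement attains this rate.\<close>

lemma ks_entropy_cone_measure_ge:
  "ereal (- (p * ln p + (1 - p) * ln (1 - p))) \<le> ks_entropy cone_map cone_measure"
proof -
  let ?h = "- (p * ln p + (1 - p) * ln (1 - p))"
  interpret mpt cone_measure cone_map by (rule mpt_invariant_prob_measures[OF cone_measure_invariant])
  note space = space_invariant_prob_measures[OF cone_measure_invariant]
  note low = simple_function_low[OF cone_measure_invariant]
  have sh: "shannon (itinerary cone_map low n) = real n * ?h" for n
  proof -
    have "(\<Sum>w\<in>itinerary cone_map low n ` space cone_measure. prob_eq (itinerary cone_map low n) w *
        ln (prob_eq (itinerary cone_map low n) w)) =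
      (\<Sum>w\<in>{w. length w = n}. prob_eq (itinerary cone_map low n) w * ln (prob_eq (itinerary cone_map low n) w))"
      by (rule sum.mono_neutral_left) (auto simp: finite_bool_lists prob_eq_notin)
    also have "\<dots> = (\<Sum>w\<in>{w. length w = n}. word_prob w * ln (word_prob w))"
      by (intro sum.cong) (simp_all add: prob_eq_def measure_itinerary_eq)
    finally show ?thesis by (simp only: shannon_def word_entropy)
  qed
  let ?A = "\<lambda>b. {q \<in> space cone_measure. low q = b}"
  have A: "?A b \<in> sets cone_measure" for b
  proof -
    have "?A b = low -` {b} \<inter> space cone_measure" by auto
    then show ?thesis using simple_functionD(2)[OF low] by simp
  qed
  \<comment> \<open>Neither cell may be empty, since \<open>partition_on\<close> excludes the empty
    set.\<close>
  have "(0, 0) \<in> ?A True" "(1, 1) \<in> ?A False" by (auto simp: space mem_unit_square low_def)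
  then have P: "finite_measurable_partition cone_measure {?A True, ?A False}"
    unfolding finite_measurable_partition_def using A[of True] A[of False]
    by (auto simp: partition_on_def disjoint_def)
  then have part: "partition_on (space cone_measure) {?A True, ?A False}"
    by (simp add: finite_measurable_partition_def)
  have cell: "cell_of {?A True, ?A False} q = ?A (low q)" if "q \<in> space cone_measure" for q
    using that by (intro cell_of_eq[OF part]) auto
  have "ereal ?h = rate low"
  proof -
    have "(\<lambda>n. ereal (shannon (itinerary cone_map low n) / real n)) \<longlonglongrightarrow> ereal ?h"
      by (rule Lim_transform_eventually[where f = "\<lambda>_. ereal ?h"])
        (auto simp: sh eventually_sequentially intro!: exI[of _ 1])
    then show ?thesis unfolding rate_def by (intro lim_imp_Limsup[symmetric]) auto
  qed
  also have "rate low \<le> rate (cell_of {?A True, ?A False}) + ereal 0"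
  proof (rule rate_le_add)
    fix n
    have "shannon (itinerary cone_map low n) \<le> shannon (itinerary cone_map (cell_of {?A True, ?A False}) n)"
    proof (rule shannon_le_of_factor[OF simple_function_itinerary[OF simple_function_cell_of[OF P]]])
      fix x y assume x: "x \<in> space cone_measure" and y: "y \<in> space cone_measure"
        and eq: "itinerary cone_map (cell_of {?A True, ?A False}) n x = itinerary cone_map (cell_of {?A True, ?A False}) n y"
      show "itinerary cone_map low n x = itinerary cone_map low n y"
        unfolding itinerary_eq_iff
      proof (intro allI impI)
        fix k assume "k < n"
        with eq have "?A (low ((cone_map ^^ k) x)) = ?A (low ((cone_map ^^ k) y))"
          unfolding itinerary_eq_iff using cell[OF T_pow_space[OF x, of k]] cell[OF T_pow_space[OF y, of k]] by simp
        then show "low ((cone_map ^^ k) x) = low ((cone_map ^^ k) y)"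
          using T_pow_space[OF x, of k] by blast
      qed
    qed
    then show "shannon (itinerary cone_map low n) \<le> shannon (itinerary cone_map (cell_of {?A True, ?A False}) n) + 0"
      by simp
  qed simp
  also have "\<dots> = ks_entropy_partition cone_measure cone_map {?A True, ?A False}"
    by (simp only: ks_entropy_partition_eq_rate[OF P] zero_ereal_def[symmetric] add_0_right)
  also have "\<dots> \<le> ks_entropy cone_map cone_measure"
    unfolding ks_entropy_def using P by (intro SUP_upper) simp
  finally show ?thesis .
qed

end

lemma SUP_ks_entropy_cone_map:
  "(SUP \<mu>\<in>invariant_prob_measures unit_square cone_map. ks_entropy cone_map \<mu>) = ereal (ln 2)" (is "?S = _")
proof (rule antisym)
  show "?S \<le> ereal (ln 2)" by (intro SUP_least ks_entropy_cone_map_le)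
  \<comment> \<open>The shift by 3 keeps \<open>p n\<close> positive from \<open>n = 0\<close>
    on.\<close>
  define p where "p n = 1 / 2 - 1 / real (n + 3)" for n
  have p: "0 < p n" "p n < 1 / 2" for n by (simp_all add: p_def)
  have "(\<lambda>n. - (p n * ln (p n) + (1 - p n) * ln (1 - p n))) \<longlonglongrightarrow> - (1 / 2 * ln (1 / 2) + (1 - 1 / 2) * ln (1 - 1 / 2))"
  proof -
    have "p \<longlonglongrightarrow> 1 / 2" unfolding p_def by real_asymp
    then show ?thesis by (intro tendsto_intros) auto
  qed
  also have "- (1 / 2 * ln (1 / 2) + (1 - 1 / 2) * ln (1 - 1 / 2)) = ln (2 :: real)"
    by (simp add: ln_div)
  finally have lim: "(\<lambda>n. ereal (- (p n * ln (p n) + (1 - p n) * ln (1 - p n)))) \<longlonglongrightarrow> ereal (ln 2)"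
    by simp
  have le: "ereal (- (p n * ln (p n) + (1 - p n) * ln (1 - p n))) \<le> ?S" for n
    using ks_entropy_cone_measure_ge[OF p, of n] cone_measure_invariant[OF p, of n]
    by (rule order_trans[OF _ SUP_upper])
  show "ereal (ln 2) \<le> ?S" by (rule LIMSEQ_le_const2[OF lim]) (use le in blast)
qed

section \<open>Topological entropy\<close>

fun stays_below :: "nat \<Rightarrow> nat \<Rightarrow> bool list \<Rightarrow> bool" where
  "stays_below K j [] \<longleftrightarrow> j \<le> K"
| "stays_below K j (b # w) \<longleftrightarrow> j \<le> K \<and> stays_below K (level_step b j) w"

lemma stays_below_take: "stays_below K j w \<Longrightarrow> fold level_step (take k w) j \<le> K"
proof (induction w arbitrary: j k)
  case (Cons b w)
  then show ?case by (cases k) auto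
qed simp

text \<open>The weights \<open>cos ((j + 1/2) \<theta>)\<close> are eigenvector entries of the walk that is reflected at level \<open>0\<close>
  and killed above level \<open>K\<close>: they vanish at \<open>K + 1\<close> by the choice of \<open>\<theta>\<close>.\<close>

lemma card_stays_below_ge:
  fixes K :: nat
  defines "\<theta> \<equiv> pi / real (2 * K + 3)"
  assumes "j \<le> Suc K"
  shows "(2 * cos \<theta>) ^ n * cos ((real j + 1 / 2) * \<theta>) \<le> real (card {w. length w = n \<and> stays_below K j w})"
  using assms(2)
proof (induction n arbitrary: j)
  case 0
  show ?case
  proof (cases "j = Suc K")
    case True
    have "(real j + 1 / 2) * \<theta> = pi / 2" by (simp add: True \<theta>_def field_simps)
    then have "cos ((real j + 1 / 2) * \<theta>) = 0" by (simp only: cos_pi_half)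
    then show ?thesis by simp
  next
    case False
    with 0 have "{w. length w = 0 \<and> stays_below K j w} = {[]}" by auto
    then show ?thesis by simp
  qed
next
  case (Suc n)
  show ?case
  \<comment> \<open>The killed level belongs to the claim because the induction step at
    \<open>j = K\<close> refers to it; there the weight is \<open>cos (pi / 2)\<close>.\<close>
  proof (cases "j = Suc K")
    case True
    have "(real j + 1 / 2) * \<theta> = pi / 2" by (simp add: True \<theta>_def field_simps)
    then have "cos ((real j + 1 / 2) * \<theta>) = 0" by (simp only: cos_pi_half)
    then show ?thesis by simp
  next
    case False
    with Suc.prems have j: "j \<le> K" by simp
    let ?W = "\<lambda>j. {w. length w = n \<and> stays_below K j w}"
    have fin: "finite (?W i)" for i
      by (rule finite_subset[OF _ finite_bool_lists[of n]]) auto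
    have "{w. length w = Suc n \<and> stays_below K j w} =
      (#) True ` ?W (Suc j) \<union> (#) False ` ?W (j - 1)" (is "?L = _")
      using j by (auto simp: length_Suc_conv level_step_def image_iff split: if_splits)
    then have card: "card ?L = card (?W (Suc j)) + card (?W (j - 1))"
      using fin[of "Suc j"] fin[of "j - 1"]
      by (simp only:, subst card_Un_disjoint) (auto simp: card_image inj_on_def)
    have "cos ((real j + 1 / 2) * \<theta> + \<theta>) + cos ((real j + 1 / 2) * \<theta> - \<theta>) = 2 * cos \<theta> * cos ((real j + 1 / 2) * \<theta>)"
      by (simp add: cos_add cos_diff)
    moreover have "(real j + 1 / 2) * \<theta> + \<theta> = (real (Suc j) + 1 / 2) * \<theta>" by (simp add: algebra_simps)
    \<comment> \<open>At level 0 the resting step is matched by \<open>cos\<close> being even: the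
      arguments \<open>- \<theta> / 2\<close> and \<open>\<theta> / 2\<close> give the same weight.
      This is the purpose of the offset \<open>1 / 2\<close>.\<close>
    moreover have "cos ((real j + 1 / 2) * \<theta> - \<theta>) = cos ((real (j - 1) + 1 / 2) * \<theta>)"
    proof (cases j)
      case 0
      have "1 / 2 * \<theta> - \<theta> = - (1 / 2 * \<theta>)" by simp
      then have "cos (1 / 2 * \<theta> - \<theta>) = cos (1 / 2 * \<theta>)" by (simp only: cos_minus)
      then show ?thesis unfolding 0 by simp
    next
      case (Suc i)
      then show ?thesis by (simp add: algebra_simps)
    qed
    ultimately have eig: "2 * cos \<theta> * cos ((real j + 1 / 2) * \<theta>) =
      cos ((real (Suc j) + 1 / 2) * \<theta>) + cos ((real (j - 1) + 1 / 2) * \<theta>)" by simp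
    have "(2 * cos \<theta>) ^ Suc n * cos ((real j + 1 / 2) * \<theta>) =
      (2 * cos \<theta>) ^ n * (2 * cos \<theta> * cos ((real j + 1 / 2) * \<theta>))" by simp
    also have "\<dots> = (2 * cos \<theta>) ^ n * cos ((real (Suc j) + 1 / 2) * \<theta>) +
      (2 * cos \<theta>) ^ n * cos ((real (j - 1) + 1 / 2) * \<theta>)"
      unfolding eig by (rule distrib_left)
    also have "\<dots> \<le> real (card (?W (Suc j))) + real (card (?W (j - 1)))"
      using j by (intro add_mono Suc.IH) auto
    finally show ?thesis unfolding card by simp
  qed
qed

text \<open>At the first time the words differ, both orbits have the same level
  \<open>j \<le> K\<close>. One slope is then at most \<open>1/4\<close> and the other at least
  \<open>1/2\<close>, so the first coordinates differ by at least a quarter of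
  \<open>(1 / 2) ^ j\<close>.\<close>

lemma symbolic_points_separated:
  assumes "length v = n" "length w = n" "v \<noteq> w" "stays_below K 0 v" "stays_below K 0 w"
  shows "\<exists>k<n. (1 / 2) ^ (K + 2) \<le> dist ((cone_map ^^ k) (symbolic_point (0, v @- \<omega>)))
    ((cone_map ^^ k) (symbolic_point (0, w @- \<omega>)))"
proof -
  define k where "k = (LEAST k. k < n \<and> v ! k \<noteq> w ! k)"
  have "length v = length w" using assms(1,2) by simp
  then have "\<exists>k. k < n \<and> v ! k \<noteq> w ! k" using assms(1,3) nth_equalityI[of v w] by blast
  then have k: "k < n" "v ! k \<noteq> w ! k" unfolding k_def by (rule LeastI2_ex; simp)+
  have "v ! i = w ! i" if "i < k" for i
    using not_less_Least[OF that[unfolded k_def]] that k(1) by simp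
  then have take: "take k v = take k w"
    using assms(1,2) k(1) by (intro nth_equalityI) auto
  define j where "j = fold level_step (take k v) 0"
  have j: "j \<le> K" unfolding j_def by (rule stays_below_take[OF assms(4)])
  have pt: "(cone_map ^^ k) (symbolic_point (0, u @- \<omega>)) = symbolic_point (j, sdrop k (u @- \<omega>))"
    "shd (sdrop k (u @- \<omega>)) = u ! k" if "u = v \<or> u = w" for u
    using that assms(1,2) k(1) take
    by (auto simp: cone_map_pow_symbolic_point level_shift_pow stake_shift j_def sdrop_shift hd_drop_conv_nth
        simp flip: sdrop_simps(1))
  let ?V = "(j, sdrop k (v @- \<omega>))" and ?W = "(j, sdrop k (w @- \<omega>))"
  have "(1 / 2) ^ j / 4 \<le> \<bar>limit_x ?V - limit_x ?W\<bar>"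
  proof (cases "v ! k")
    case True
    with k(2) have "\<not> w ! k" by simp
    with True show ?thesis
      using symbolic_point_bounds(1)[of ?V] symbolic_point_bounds(2)[of ?W] pt(2)[of v] pt(2)[of w]
      by (simp add: abs_if)
  next
    case False
    with k(2) have "w ! k" by simp
    with False show ?thesis
      using symbolic_point_bounds(2)[of ?V] symbolic_point_bounds(1)[of ?W] pt(2)[of v] pt(2)[of w]
      by (simp add: abs_if)
  qed
  moreover have "(1 / 2 :: real) ^ K \<le> (1 / 2) ^ j" using j by (intro power_decreasing) auto
  moreover have "\<bar>limit_x ?V - limit_x ?W\<bar> = dist (symbolic_point ?V) (symbolic_point ?W)"
    by (simp add: symbolic_point_def dist_prod_def dist_real_def)
  moreover have "(1 / 2 :: real) ^ (K + 2) = (1 / 2) ^ K / 4" by (simp add: power_add power_divide)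
  ultimately have "(1 / 2) ^ (K + 2) \<le> dist (symbolic_point ?V) (symbolic_point ?W)" by linarith
  then show ?thesis using k(1) pt(1)[of v] pt(1)[of w] by auto
qed

text \<open>The scale is half of the separation \<open>(1 / 2) ^ (K + 2)\<close>, so one point of
  \<open>E\<close> cannot follow the orbits of two different words.\<close>

lemma card_spanning_set_ge:
  assumes E: "spanning_set unit_square cone_map n ((1 / 2) ^ (K + 3)) E"
  shows "card {w. length w = n \<and> stays_below K 0 w} \<le> card E"
proof -
  let ?W = "{w. length w = n \<and> stays_below K 0 w}" and ?e = "(1 / 2 :: real) ^ (K + 3)"
  let ?pt = "\<lambda>w. symbolic_point (0, w @- sconst True)"
  have "\<exists>y\<in>E. \<forall>k<n. dist ((cone_map ^^ k) (?pt w)) ((cone_map ^^ k) y) < ?e" for w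
    using E symbolic_point_mem by (simp add: spanning_set_def)
  then obtain y where y: "\<And>w. y w \<in> E"
    "\<And>w k. k < n \<Longrightarrow> dist ((cone_map ^^ k) (?pt w)) ((cone_map ^^ k) (y w)) < ?e" by metis
  have "inj_on y ?W"
  proof (rule inj_onI, rule ccontr)
    fix v w assume vw: "v \<in> ?W" "w \<in> ?W" "y v = y w" "v \<noteq> w"
    then obtain k where k: "k < n" "(1 / 2) ^ (K + 2) \<le> dist ((cone_map ^^ k) (?pt v)) ((cone_map ^^ k) (?pt w))"
      using symbolic_points_separated[of v n w K "sconst True"] by auto
    have "dist ((cone_map ^^ k) (?pt v)) ((cone_map ^^ k) (?pt w)) < ?e + ?e"
      using y(2)[OF k(1), of v] y(2)[OF k(1), of w] vw(3)
      by (intro dist_triangle_less_add[of _ "(cone_map ^^ k) (y v)"]) (simp_all add: dist_commute)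
    moreover have "?e + ?e = (1 / 2) ^ (K + 2)" by (simp add: power_add power_divide)
    ultimately show False using k(2) by linarith
  qed
  moreover have "y ` ?W \<subseteq> E" using y(1) by auto
  moreover have "finite E" using E by (simp add: spanning_set_def)
  ultimately show ?thesis by (rule card_inj_on_le)
qed

text \<open>The eigenvalue \<open>2 * cos \<theta>\<close> of the killed walk is a lower bound for
  the growth rate of the words staying below \<open>K\<close>; the weight \<open>v\<close> of the
  starting level does not depend on \<open>n\<close> and vanishes in the limit.\<close>

lemma topological_entropy_cone_map_ge_ln_cos:
  "ereal (ln (2 * cos (pi / real (2 * K + 3)))) \<le> topological_entropy unit_square cone_map"
proof -
  define \<theta> where "\<theta> = pi / real (2 * K + 3)"
  define l where "l = 2 * cos \<theta>"
  define v where "v = cos (1 / 2 * \<theta>)"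
  \<comment> \<open>The denominator is at least 3, so both cosines are positive and their logarithms
    are meaningful.\<close>
  have \<theta>: "0 < \<theta>" "\<theta> < pi / 2"
    unfolding \<theta>_def by (simp, rule divide_strict_left_mono) simp_all
  have l: "0 < l" unfolding l_def using \<theta> by (intro mult_pos_pos cos_gt_zero) auto
  have v: "0 < v" unfolding v_def using \<theta> by (intro cos_gt_zero) auto
  let ?e = "(1 / 2 :: real) ^ (K + 3)"
  have le: "ereal ((real n * ln l + ln v) / real n) \<le>
    (INF E\<in>{E. spanning_set unit_square cone_map n ?e E}. ereal (ln (real (card E)) / real n))" for n
  proof (rule INF_greatest)
    fix E assume "E \<in> {E. spanning_set unit_square cone_map n ?e E}"
    then have "real (card {w. length w = n \<and> stays_below K 0 w}) \<le> real (card E)"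
      using card_spanning_set_ge by simp
    moreover have "l ^ n * v \<le> real (card {w. length w = n \<and> stays_below K 0 w})"
      using card_stays_below_ge[of 0 K n] by (simp add: l_def v_def \<theta>_def)
    ultimately have "ln (l ^ n * v) \<le> ln (real (card E))"
      using l v by (intro ln_mono) auto
    moreover have "ln (l ^ n * v) = real n * ln l + ln v" using l v by (simp add: ln_mult ln_realpow)
    ultimately show "ereal ((real n * ln l + ln v) / real n) \<le> ereal (ln (real (card E)) / real n)"
      by (simp add: divide_right_mono)
  qed
  have "(\<lambda>n. (real n * ln l + ln v) / real n) \<longlonglongrightarrow> ln l" by real_asymp
  then have "ereal (ln l) = limsup (\<lambda>n. ereal ((real n * ln l + ln v) / real n))"
    by (intro lim_imp_Limsup[symmetric]) auto
  also have "\<dots> \<le> limsup (\<lambda>n. INF E\<in>{E. spanning_set unit_square cone_map n ?e E}. ereal (ln (real (card E)) / real n))"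
    by (intro Limsup_mono always_eventually allI le)
  also have "\<dots> \<le> topological_entropy unit_square cone_map"
    unfolding topological_entropy_def by (rule SUP_upper) simp
  finally show ?thesis by (simp add: l_def \<theta>_def)
qed

lemma topological_entropy_cone_map: "topological_entropy unit_square cone_map = ereal (ln 2)"
proof (rule antisym[OF topological_entropy_cone_map_le])
  have "(\<lambda>K. pi / real (2 * K + 3)) \<longlonglongrightarrow> 0" by real_asymp
  then have "(\<lambda>K. ln (2 * cos (pi / real (2 * K + 3)))) \<longlonglongrightarrow> ln (2 * cos 0)"
    by (intro tendsto_intros) auto
  then have lim: "(\<lambda>K. ereal (ln (2 * cos (pi / real (2 * K + 3))))) \<longlonglongrightarrow> ereal (ln 2)" by simp
  show "ereal (ln 2) \<le> topological_entropy unit_square cone_map"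
    by (rule LIMSEQ_le_const2[OF lim]) (use topological_entropy_cone_map_ge_ln_cos in blast)
qed

section \<open>Continuity and affine pieces of the map\<close>

lemma continuous_on_cone_map: "continuous_on S cone_map"
  unfolding cone_map_def case_prod_unfold by (intro continuous_intros) simp_all

text \<open>The definition allows pieces of any shape, so they may be taken as the fibres of an
  arbitrary choice, at each point, of an affine map that agrees with \<open>T\<close> there.\<close>

lemma piecewise_affine_onI:
  assumes "finite F" "\<And>f. f \<in> F \<Longrightarrow> \<exists>L b. linear L \<and> (\<forall>x. f x = L x + b)"
    and "\<And>x. x \<in> S \<Longrightarrow> \<exists>f\<in>F. T x = f x"
  shows "piecewise_affine_on S T"
proof -
  obtain g where g: "\<And>x. x \<in> S \<Longrightarrow> g x \<in> F" "\<And>x. x \<in> S \<Longrightarrow> T x = g x x"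
    using assms(3) by metis
  let ?P = "(\<lambda>f. {x \<in> S. g x = f}) ` F - {{}}"
  have "partition_on S ?P" using g(1) by (auto simp: partition_on_def disjoint_def)
  moreover have "\<exists>L b. linear L \<and> (\<forall>x\<in>A. T x = L x + b)" if A: "A \<in> ?P" for A
  proof -
    obtain f where f: "f \<in> F" "A = {x \<in> S. g x = f}" using A by blast
    then obtain L b where "linear L" "\<And>x. f x = L x + b" using assms(2) by blast
    with f(2) g(2) show ?thesis by (intro exI[of _ L] exI[of _ b]) auto
  qed
  ultimately show ?thesis unfolding piecewise_affine_on_def
    using assms(1) by (intro exI[of _ ?P]) simp
qed

definition affine_plane_map :: "real \<Rightarrow> real \<Rightarrow> real \<Rightarrow> real \<Rightarrow> real \<Rightarrow> real \<Rightarrow> real \<times> real \<Rightarrow> real \<times> real" where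
  "affine_plane_map a b c d e f p = (a * fst p + b * snd p + e, c * fst p + d * snd p + f)"

lemma affine_plane_map_eq: "\<exists>L v. linear L \<and> (\<forall>p. affine_plane_map a b c d e f p = L p + v)"
proof (intro exI conjI allI)
  show "linear (affine_plane_map a b c d 0 0)"
    by (rule linearI) (simp_all add: affine_plane_map_def algebra_simps)
  show "affine_plane_map a b c d e f p = affine_plane_map a b c d 0 0 p + (e, f)" for p
    by (simp add: affine_plane_map_def)
qed

text \<open>One map serves the halving branch; the strip, the doubling branch and the part below the
  diagonal have two each, with and without clipping. The corner map \<open>(1, 1)\<close> also
  covers the points clipped in the first coordinate, which makes seven in all.\<close>

lemma piecewise_affine_on_cone_map: "piecewise_affine_on unit_square cone_map"
proof (rule piecewise_affine_onI)
  let ?F = "{affine_plane_map 2 0 0 (1 / 2) 0 0, affine_plane_map 6 (- 1) 6 (- 1) 0 0,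
    affine_plane_map 0 0 0 0 1 1, affine_plane_map (- 4) 4 0 2 0 0, affine_plane_map (- 4) 4 0 0 0 1,
    affine_plane_map 0 0 0 2 0 0, affine_plane_map 0 0 0 0 0 1}"
  show "finite ?F" by simp
  show "\<exists>L b. linear L \<and> (\<forall>x. f x = L x + b)" if "f \<in> ?F" for f
    using that affine_plane_map_eq by auto
  fix q assume q: "q \<in> unit_square"
  consider "low q" | "\<not> low q" "2 * fst q < snd q" | "snd q < fst q" |
    "snd q \<le> 2 * fst q" "fst q \<le> snd q" "1 < 4 * (snd q - fst q)" |
    "snd q \<le> 2 * fst q" "fst q \<le> snd q" "4 * (snd q - fst q) \<le> 1" by linarith
  then show "\<exists>f\<in>?F. cone_map q = f q"
    using cone_map_low[OF q] cone_map_middle[OF q] cone_map_below_diagonal[OF q]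
      cone_map_clipped[OF q] cone_map_high[OF q]
    by cases (auto simp: affine_plane_map_def min_def)
qed

theorem theorem1p3:
  shows "\<exists>T :: real \<times> real \<Rightarrow> real \<times> real.
    T ` unit_square \<subseteq> unit_square \<and>
    piecewise_affine_on unit_square T \<and>
    continuous_on unit_square T \<and>
    topological_entropy unit_square T = ereal (ln 2) \<and>
    (SUP \<mu>\<in>invariant_prob_measures unit_square T. ks_entropy T \<mu>) = ereal (ln 2) \<and>
    \<not> (\<exists>\<mu>. maximal_entropy_measure unit_square T \<mu>)"
proof (intro exI[of _ cone_map] conjI)
  show "cone_map ` unit_square \<subseteq> unit_square" using cone_map_mem by auto
  show "\<not> (\<exists>\<mu>. maximal_entropy_measure unit_square cone_map \<mu>)"
    using ks_entropy_cone_map_neq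
    by (auto simp: maximal_entropy_measure_def topological_entropy_cone_map)
qed (rule piecewise_affine_on_cone_map continuous_on_cone_map topological_entropy_cone_map
    SUP_ks_entropy_cone_map)+

end
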